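(* Fix convention E ($\varepsilon=0$) or N ($\varepsilon=1$) and put $k_0=\varepsilon$. For the extremal (smallest/largest consistent prefix) rules every deterministic learner has $M+Q\ge T-\varepsilon$ on some instance; this statement does not extend to every pre-declared memoryless selection rule. Precisely: (1) Feasible-median rule. Let $\mathcal R_{\rm feas}(S,\preceq)$ return the prefix whose cutoff is $\lfloor(\ell+u)/2\rfloor$, where $[\ell,u]$ is the interval of feasible cutoffs of $S$ under $\preceq$, and $\bot$ if that interval is empty. Then $\mathcal R_{\rm feas}$ is a legal memoryless consistency-type ERM oracle, and for $T\ge2$ there is a deterministic learner with $Q\le\lceil\log_2T\rceil$ and $M\le\lceil\log_2T\rceil$ on every instance (order and target). For $T=1$ no query is needed, and the learner makes at most one mistake under E and none under N (under E with $T=1$ there are two legal targets, so zero mistakes cannot be guaranteed by any learner). (2) Global-median rule. Let $m=\lfloor(k_0+T)/2\rfloor$ and let $\mathcal R_{\rm global}(S,\preceq)$ return $\bot$ if $S$ is unrealizable and otherwise the prefix with cutoff $\min\{u,\max\{\ell,m\}\}$, where $[\ell,u]$ is the feasible cutoff interval. Under this rule there is a deterministic learner making one query and at most $\lceil T/2\rceil$ mistakes on every instance, while every deterministic learner has $M+Q\ge T-m$ on some instance. Consequently no deterministic learner achieves both $O(\log T)$ mistakes and $O(\log T)$ calls under $\mathcal R_{\rm global}$.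
   Context: Domain and conventions. $T\ge1$ distinct instances are announced in advance as a sequence $x_1,\dots,x_T$. Convention E: $X=\{s,x_1,\dots,x_T\}$ and only total orders on $X$ in which the sentinel $s$ is the minimum are admissible. Convention N: $X=\{x_1,\dots,x_T\}$, all total orders on $X$ are admissible. For a total order $\preceq$ on $X$ and $z\in X$ let $c_z(x)=\mathbf 1[x\preceq z]$ and $C_\preceq=\{c_z:z\in X\}$. Cutoffs. Concepts in $C_\preceq$ are indexed by their cutoff $k$, the number of positively labeled instances among $x_1,\dots,x_T$; $k$ ranges over $\{0,\dots,T\}$ under E and over $\{1,\dots,T\}$ under N, i.e. over $\{k_0,\dots,T\}$. For a sample $S\subseteq X\times\{0,1\}$ the cutoffs of the concepts consistent with $S$ form an integer interval $[\ell,u]$, possibly empty (then $S$ is unrealizable). Oracle. A selection rule $\mathcal R(S,\preceq)$ is a legal memoryless consistency-type ERM oracle if for every admissible order $\preceq$ and every sample $S$ it returns a concept of $C_\preceq$ consistent with $S$ (observed as a full label vector on $X$), or $\bot$ exactly when none exists, depending only on $(S,\preceq)$. The rule is announced before the learner. Protocol. The learner knows the convention, $X$, $T$, the sequence and the rule, but not $\preceq$ or $z$. In round $t$ it predicts $\hat y_t\in\{0,1\}$ and then sees $y_t=c_z(x_t)$; at any time it may call the oracle $S\mapsto\mathcal R(S,\preceq)$ on any adaptively chosen sample. $M$ is the number of mistakes, $Q$ the number of calls. An instance is a pair (admissible order $\preceq$, target $z\in X$). *)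

theory Defs
  imports Complex_Main "HOL-Library.Landau_Symbols"
begin

datatype convention = ConvE | ConvN

fun eps :: "convention \<Rightarrow> nat" where
  "eps ConvE = 0"
| "eps ConvN = 1"

text \<open>
  The announced sequence is the list \<open>xs\<close>, so \<open>T = length xs\<close>. The sentinel \<open>s\<close> plays no role
  under \<open>ConvN\<close>.
\<close>

definition announced :: "convention \<Rightarrow> 'a \<Rightarrow> 'a list \<Rightarrow> bool" where
  "announced c s xs \<longleftrightarrow> xs \<noteq> [] \<and> distinct xs \<and> (c = ConvE \<longrightarrow> s \<notin> set xs)"

definition points :: "convention \<Rightarrow> 'a \<Rightarrow> 'a list \<Rightarrow> 'a set" where
  "points c s xs = (if c = ConvE then insert s (set xs) else set xs)"

definition admissible :: "convention \<Rightarrow> 'a \<Rightarrow> 'a list \<Rightarrow> 'a rel \<Rightarrow> bool" where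
  "admissible c s xs r \<longleftrightarrow>
     linear_order_on (points c s xs) r \<and>
     (c = ConvE \<longrightarrow> (\<forall>x \<in> points c s xs. (s, x) \<in> r))"

text \<open>
  Labels are Booleans. Since \<open>r \<subseteq> X \<times> X\<close>, a concept is \<open>False\<close> outside \<open>X\<close>, so these functions
  carry exactly the label vector on \<open>X\<close>.
\<close>

definition threshold :: "'a rel \<Rightarrow> 'a \<Rightarrow> 'a \<Rightarrow> bool" where
  "threshold r z = (\<lambda>x. (x, z) \<in> r)"

definition concepts :: "convention \<Rightarrow> 'a \<Rightarrow> 'a list \<Rightarrow> 'a rel \<Rightarrow> ('a \<Rightarrow> bool) set" where
  "concepts c s xs r = threshold r ` points c s xs"

type_synonym 'a sample = "('a \<times> bool) set"

definition consistent :: "('a \<Rightarrow> bool) \<Rightarrow> 'a sample \<Rightarrow> bool" where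
  "consistent h S \<longleftrightarrow> (\<forall>(x, y) \<in> S. h x = y)"

definition cutoff :: "'a list \<Rightarrow> ('a \<Rightarrow> bool) \<Rightarrow> nat" where
  "cutoff xs h = card {x \<in> set xs. h x}"

definition feasible_cutoffs ::
    "convention \<Rightarrow> 'a \<Rightarrow> 'a list \<Rightarrow> 'a sample \<Rightarrow> 'a rel \<Rightarrow> nat set" where
  "feasible_cutoffs c s xs S r = cutoff xs ` {h \<in> concepts c s xs r. consistent h S}"

definition prefix_concept ::
    "convention \<Rightarrow> 'a \<Rightarrow> 'a list \<Rightarrow> 'a rel \<Rightarrow> nat \<Rightarrow> 'a \<Rightarrow> bool" where
  "prefix_concept c s xs r k = (THE h. h \<in> concepts c s xs r \<and> cutoff xs h = k)"

text \<open>A selection rule; \<open>None\<close> stands for \<open>\<bottom>\<close>. Being a function of \<open>(S, r)\<close>, it is memoryless.\<close>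

type_synonym 'a rule = "'a sample \<Rightarrow> 'a rel \<Rightarrow> ('a \<Rightarrow> bool) option"

definition legal_oracle :: "convention \<Rightarrow> 'a \<Rightarrow> 'a list \<Rightarrow> 'a rule \<Rightarrow> bool" where
  "legal_oracle c s xs R \<longleftrightarrow>
     (\<forall>r S. admissible c s xs r \<and> S \<subseteq> points c s xs \<times> UNIV \<longrightarrow>
        (case R S r of
           None \<Rightarrow> \<not> (\<exists>h \<in> concepts c s xs r. consistent h S)
         | Some h \<Rightarrow> h \<in> concepts c s xs r \<and> consistent h S))"

text \<open>\<open>f l u\<close> is the selected cutoff when the interval of feasible cutoffs is \<open>{l..u}\<close>.\<close>

definition cutoff_rule ::
    "convention \<Rightarrow> 'a \<Rightarrow> 'a list \<Rightarrow> (nat \<Rightarrow> nat \<Rightarrow> nat) \<Rightarrow> 'a rule" where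
  "cutoff_rule c s xs f S r =
     (let F = feasible_cutoffs c s xs S r
      in if F = {} then None else Some (prefix_concept c s xs r (f (Min F) (Max F))))"

definition smallest_rule :: "convention \<Rightarrow> 'a \<Rightarrow> 'a list \<Rightarrow> 'a rule" where
  "smallest_rule c s xs = cutoff_rule c s xs (\<lambda>l u. l)"

definition largest_rule :: "convention \<Rightarrow> 'a \<Rightarrow> 'a list \<Rightarrow> 'a rule" where
  "largest_rule c s xs = cutoff_rule c s xs (\<lambda>l u. u)"

definition feasible_median_rule :: "convention \<Rightarrow> 'a \<Rightarrow> 'a list \<Rightarrow> 'a rule" where
  "feasible_median_rule c s xs = cutoff_rule c s xs (\<lambda>l u. (l + u) div 2)"

definition global_median :: "convention \<Rightarrow> 'a list \<Rightarrow> nat" where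
  "global_median c xs = (eps c + length xs) div 2"

definition global_median_rule :: "convention \<Rightarrow> 'a \<Rightarrow> 'a list \<Rightarrow> 'a rule" where
  "global_median_rule c s xs =
     cutoff_rule c s xs (\<lambda>l u. min u (max l (global_median c xs)))"

text \<open>
  A deterministic learner is a strategy tree: \<open>Query S k\<close> calls the oracle on \<open>S\<close> and continues
  with \<open>k\<close> applied to the answer; \<open>Predict b k\<close> predicts \<open>b\<close> in the current round and continues
  with \<open>k\<close> applied to the revealed label; \<open>Halt\<close> makes no further call and predicts \<open>False\<close> in all
  remaining rounds. The continuations may depend on the whole transcript. Trees have no infinite
  branch, so a learner makes finitely many calls on every run; a learner calling the oracle forever
  would have \<open>Q = \<infinity>\<close>, so leaving it out affects neither the upper nor the lower bounds.
\<close>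

datatype 'a learner =
    Halt
  | Query "('a \<times> bool) set" "('a \<Rightarrow> bool) option \<Rightarrow> 'a learner"
  | Predict bool "bool \<Rightarrow> 'a learner"

primrec queries_within :: "'a set \<Rightarrow> 'a learner \<Rightarrow> bool" where
  "queries_within X Halt \<longleftrightarrow> True"
| "queries_within X (Query S k) \<longleftrightarrow> S \<subseteq> X \<times> UNIV \<and> (\<forall>a. queries_within X (k a))"
| "queries_within X (Predict b k) \<longleftrightarrow> (\<forall>y. queries_within X (k y))"

definition learners :: "convention \<Rightarrow> 'a \<Rightarrow> 'a list \<Rightarrow> 'a learner set" where
  "learners c s xs = {L. queries_within (points c s xs) L}"

text \<open>
  Runs against the oracle \<open>orc\<close> and the target \<open>h\<close>; the list holds the instances still to be
  presented. Calls made after the last round are counted too.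
\<close>

primrec mistakes ::
    "'a learner \<Rightarrow> ('a sample \<Rightarrow> ('a \<Rightarrow> bool) option) \<Rightarrow> ('a \<Rightarrow> bool) \<Rightarrow> 'a list \<Rightarrow> nat" where
  "mistakes Halt orc h xs = length (filter h xs)"
| "mistakes (Query S k) orc h xs = mistakes (k (orc S)) orc h xs"
| "mistakes (Predict b k) orc h xs =
     (case xs of
        [] \<Rightarrow> 0
      | x # xs' \<Rightarrow> (if b = h x then 0 else 1) + mistakes (k (h x)) orc h xs')"

primrec calls ::
    "'a learner \<Rightarrow> ('a sample \<Rightarrow> ('a \<Rightarrow> bool) option) \<Rightarrow> ('a \<Rightarrow> bool) \<Rightarrow> 'a list \<Rightarrow> nat" where
  "calls Halt orc h xs = 0"
| "calls (Query S k) orc h xs = 1 + calls (k (orc S)) orc h xs"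
| "calls (Predict b k) orc h xs =
     (case xs of
        [] \<Rightarrow> 0
      | x # xs' \<Rightarrow> calls (k (h x)) orc h xs')"

definition problem_instances :: "convention \<Rightarrow> 'a \<Rightarrow> 'a list \<Rightarrow> ('a rel \<times> 'a) set" where
  "problem_instances c s xs = {(r, z). admissible c s xs r \<and> z \<in> points c s xs}"

definition num_mistakes :: "'a rule \<Rightarrow> 'a list \<Rightarrow> 'a learner \<Rightarrow> 'a rel \<times> 'a \<Rightarrow> nat" where
  "num_mistakes R xs L = (\<lambda>(r, z). mistakes L (\<lambda>S. R S r) (threshold r z) xs)"

definition num_calls :: "'a rule \<Rightarrow> 'a list \<Rightarrow> 'a learner \<Rightarrow> 'a rel \<times> 'a \<Rightarrow> nat" where
  "num_calls R xs L = (\<lambda>(r, z). calls L (\<lambda>S. R S r) (threshold r z) xs)"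

definition forces_total :: "convention \<Rightarrow> 'a \<Rightarrow> 'a list \<Rightarrow> 'a rule \<Rightarrow> nat \<Rightarrow> bool" where
  "forces_total c s xs R B \<longleftrightarrow>
     (\<forall>L \<in> learners c s xs. \<exists>I \<in> problem_instances c s xs.
        num_mistakes R xs L I + num_calls R xs L I \<ge> B)"

end

theory Submission
  imports Defs
begin

text \<open>
  Lower bounds. The smallest, largest and global-median rules pick the feasible cutoff nearest to
  a fixed \<open>m\<close>, where \<open>m\<close> is \<open>k\<^sub>0\<close>, \<open>T\<close> and the global median, respectively. An
  adversary keeps a bottom and a top segment and a set \<open>U\<close> of uncommitted elements between them.
  If the bottom segment reaches \<open>m\<close>, the answer to a sample can depend on the order inside
  \<open>U\<close> only if some \<open>a \<in> U\<close> is labelled positive in it; making \<open>a\<close> the maximum of \<open>U\<close> then fixes the answer. The case \<open>m = T\<close> is dual. A prediction on an element of \<open>U\<close>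
  is made wrong by moving it to the suitable end. So each unit of cost removes at most one element
  of \<open>U\<close>, and \<open>U\<close> may start with \<open>T - m\<close> (dually, \<open>T - k\<^sub>0\<close>) elements.

  Upper bounds. For the global median, one call on the empty sample returns the prefix with cutoff
  \<open>m\<close>, which differs from any target in at most \<open>max (m - k\<^sub>0) (T - m)\<close> points. For the feasible
  median, the learner asks for the median consistent with the labels seen so far, follows it until
  it errs, and asks again.
\<close>

section \<open>Concepts as an increasing chain indexed by cutoffs\<close>

locale setting =
  fixes c :: convention and s :: 'a and xs :: "'a list"
  assumes ann: "announced c s xs"
begin

abbreviation "X \<equiv> points c s xs"
abbreviation "T \<equiv> length xs"
abbreviation "pos_count \<equiv> cutoff xs"

lemma xs_nonempty: "xs \<noteq> []" and xs_distinct: "distinct xs"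
  using ann by (auto simp: announced_def)

lemma finite_points: "finite X"
  by (auto simp: points_def)

lemma card_points: "card X + eps c = Suc T"
  using ann by (cases c) (auto simp: points_def announced_def distinct_card)

lemma eps_le: "eps c \<le> T"
  using xs_nonempty by (cases c; cases xs) auto

lemma card_set_xs: "card (set xs) = T"
  using xs_distinct by (rule distinct_card)

end

locale ordered_setting = setting +
  fixes r :: "'a rel"
  assumes adm: "admissible c s xs r"
begin

abbreviation "C \<equiv> concepts c s xs r"
abbreviation "pre \<equiv> prefix_concept c s xs r"
abbreviation "F \<equiv> \<lambda>S. feasible_cutoffs c s xs S r"

lemma rel_refl: "x \<in> X \<Longrightarrow> (x, x) \<in> r"
  and rel_trans: "(x, y) \<in> r \<Longrightarrow> (y, z) \<in> r \<Longrightarrow> (x, z) \<in> r"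
  and rel_antisym: "(x, y) \<in> r \<Longrightarrow> (y, x) \<in> r \<Longrightarrow> x = y"
  and rel_total: "x \<in> X \<Longrightarrow> y \<in> X \<Longrightarrow> (x, y) \<in> r \<or> (y, x) \<in> r"
  and rel_points: "(x, y) \<in> r \<Longrightarrow> x \<in> X \<and> y \<in> X"
  and sentinel_least: "c = ConvE \<Longrightarrow> x \<in> X \<Longrightarrow> (s, x) \<in> r"
proof -
  have lin: "r \<subseteq> X \<times> X" "refl_on X r" "trans r" "antisym r" "total_on X r"
    and least: "c = ConvE \<longrightarrow> (\<forall>x\<in>X. (s, x) \<in> r)"
    using adm by (auto simp: admissible_def order_on_defs)
  show "x \<in> X \<Longrightarrow> (x, x) \<in> r" using lin(2) by (rule refl_onD)
  show "(x, y) \<in> r \<Longrightarrow> (y, z) \<in> r \<Longrightarrow> (x, z) \<in> r" using lin(3) by (rule transD)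
  show "(x, y) \<in> r \<Longrightarrow> (y, x) \<in> r \<Longrightarrow> x = y" using lin(4) by (rule antisymD)
  show "x \<in> X \<Longrightarrow> y \<in> X \<Longrightarrow> (x, y) \<in> r \<or> (y, x) \<in> r"
    using lin(2,5) unfolding total_on_def by (metis refl_onD)
  show "(x, y) \<in> r \<Longrightarrow> x \<in> X \<and> y \<in> X" using lin(1) by blast
  show "c = ConvE \<Longrightarrow> x \<in> X \<Longrightarrow> (s, x) \<in> r" using least by blast
qed

lemma threshold_mono: "(z, z') \<in> r \<Longrightarrow> threshold r z x \<Longrightarrow> threshold r z' x"
  unfolding threshold_def by (rule rel_trans)

lemma cutoff_le_length: "pos_count h \<le> T"
  unfolding cutoff_def card_set_xs[symmetric] by (rule card_mono) auto

text \<open>The larger target \<open>z'\<close> is itself a new positive. It counts towards the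
  cutoff because it is announced: the sentinel, being least, cannot lie strictly above
  \<open>z\<close>.\<close>

lemma cutoff_threshold_less:
  assumes "(z, z') \<in> r" "z \<noteq> z'"
  shows "pos_count (threshold r z) < pos_count (threshold r z')"
proof -
  have z': "z' \<in> X" using assms rel_points by blast
  have "z' \<in> set xs"
  proof (rule ccontr)
    assume "z' \<notin> set xs"
    with z' have "c = ConvE" "z' = s" by (auto simp: points_def split: if_splits)
    with assms rel_antisym sentinel_least rel_points show False by blast
  qed
  moreover have "\<not> threshold r z z'" "threshold r z' z'"
    using assms rel_antisym rel_refl z' by (auto simp: threshold_def)
  ultimately have "{x \<in> set xs. threshold r z x} \<subset> {x \<in> set xs. threshold r z' x}"
    using threshold_mono[OF assms(1)] by blast
  then show ?thesis unfolding cutoff_def by (intro psubset_card_mono) auto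
qed

lemma inj_cutoff_threshold: "inj_on (\<lambda>z. pos_count (threshold r z)) X"
proof (rule inj_onI, rule ccontr)
  fix z z'
  assume "z \<in> X" "z' \<in> X" "pos_count (threshold r z) = pos_count (threshold r z')" "z \<noteq> z'"
  then show False
    using rel_total[of z z'] cutoff_threshold_less[of z z'] cutoff_threshold_less[of z' z]
    by auto
qed

text \<open>By counting: the cutoff is injective on the \<open>Suc T - eps c\<close> points and its
  values stay in a range of the same size. The lower end holds because under \<open>ConvN\<close> a
  target is an announced positive.\<close>

lemma cutoff_concepts: "pos_count ` C = {eps c..T}"
proof -
  have "eps c \<le> pos_count (threshold r z)" if "z \<in> X" for z
  proof (cases c)
    case ConvN
    with that have "z \<in> {x \<in> set xs. threshold r z x}"
      using rel_refl by (auto simp: points_def threshold_def)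
    then have "0 < card {x \<in> set xs. threshold r z x}" by (subst card_gt_0_iff) auto
    then show ?thesis using ConvN by (simp add: cutoff_def)
  qed simp
  then have "pos_count ` C \<subseteq> {eps c..T}"
    using cutoff_le_length by (auto simp: concepts_def)
  moreover have "card (pos_count ` C) = card {eps c..T}"
    using card_image[OF inj_cutoff_threshold] card_points eps_le
    by (simp add: concepts_def image_image)
  ultimately show ?thesis by (intro card_subset_eq) auto
qed

lemma cutoff_inj: "g \<in> C \<Longrightarrow> h \<in> C \<Longrightarrow> pos_count g = pos_count h \<Longrightarrow> g = h"
  using inj_cutoff_threshold by (auto simp: concepts_def inj_on_def)

lemma prefix_cutoff: "h \<in> C \<Longrightarrow> pre (pos_count h) = h"
  unfolding prefix_concept_def by (rule the_equality) (auto intro: cutoff_inj)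

lemma prefix_in_concepts: "pre k \<in> C"
  and cutoff_prefix: "pos_count (pre k) = k"
  if "k \<in> {eps c..T}"
proof -
  from that obtain h where "h \<in> C" "k = pos_count h"
    unfolding cutoff_concepts[symmetric] by blast
  then show "pre k \<in> C" "pos_count (pre k) = k" by (simp_all add: prefix_cutoff)
qed

lemma concept_cases:
  assumes "h \<in> C"
  obtains k where "k \<in> {eps c..T}" "h = pre k"
proof
  show "pos_count h \<in> {eps c..T}" unfolding cutoff_concepts[symmetric] using assms by simp
  show "h = pre (pos_count h)" using assms by (simp add: prefix_cutoff)
qed

text \<open>Cutoffs grow strictly along \<open>r\<close>, so comparing cutoffs compares the
  targets.\<close>

lemma prefix_mono:
  assumes "k \<in> {eps c..T}" "k' \<in> {eps c..T}" "k \<le> k'" "pre k x"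
  shows "pre k' x"
proof -
  obtain z z' where z: "z \<in> X" "z' \<in> X" "pre k = threshold r z" "pre k' = threshold r z'"
    using prefix_in_concepts[OF assms(1)] prefix_in_concepts[OF assms(2)]
    unfolding concepts_def by blast
  have "pos_count (threshold r z) \<le> pos_count (threshold r z')"
    using cutoff_prefix[OF assms(1)] cutoff_prefix[OF assms(2)] assms(3) z(3,4) by simp
  then have "\<not> ((z', z) \<in> r \<and> z' \<noteq> z)"
    using cutoff_threshold_less[of z' z] by auto
  then have "(z, z') \<in> r"
    using rel_total[OF z(1,2)] rel_refl[OF z(1)] by blast
  then show ?thesis using threshold_mono[of z z' x] z(3,4) assms(4) by simp
qed

lemma feasible_iff: "k \<in> F S \<longleftrightarrow> k \<in> {eps c..T} \<and> consistent (pre k) S"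
proof
  assume "k \<in> F S"
  then obtain h where h: "h \<in> C" "consistent h S" "k = pos_count h"
    by (auto simp: feasible_cutoffs_def)
  then have "k \<in> {eps c..T}" unfolding cutoff_concepts[symmetric] by simp
  with h show "k \<in> {eps c..T} \<and> consistent (pre k) S" by (simp add: prefix_cutoff)
next
  assume "k \<in> {eps c..T} \<and> consistent (pre k) S"
  then have "pre k \<in> {h \<in> C. consistent h S}" "k = pos_count (pre k)"
    using prefix_in_concepts cutoff_prefix by auto
  then show "k \<in> F S" unfolding feasible_cutoffs_def by blast
qed

lemma finite_feasible: "finite (F S)"
  by (rule finite_subset[of _ "{eps c..T}"]) (auto simp: feasible_iff)

text \<open>At every sample point the prefixes for \<open>l\<close> and \<open>u\<close> both give
  the sample label, and the prefix between them is squeezed by monotonicity.\<close>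

lemma feasible_convex:
  assumes "l \<in> F S" "u \<in> F S" "l \<le> k" "k \<le> u"
  shows "k \<in> F S"
proof -
  have k: "k \<in> {eps c..T}" using assms by (auto simp: feasible_iff)
  have "pre k x = y" if "(x, y) \<in> S" for x y
  proof -
    have "pre l x = y" "pre u x = y"
      using assms(1,2) that unfolding feasible_iff consistent_def by blast+
    moreover have "pre l x \<longrightarrow> pre k x" "pre k x \<longrightarrow> pre u x"
      using prefix_mono[of l k x] prefix_mono[of k u x] assms k unfolding feasible_iff by blast+
    ultimately show ?thesis by blast
  qed
  then have "consistent (pre k) S" unfolding consistent_def by blast
  with k show ?thesis by (simp add: feasible_iff)
qed

lemma feasible_empty_iff: "F S = {} \<longleftrightarrow> \<not> (\<exists>h \<in> C. consistent h S)"
  by (auto simp: feasible_cutoffs_def)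

lemma feasible_between:
  "F S \<noteq> {} \<Longrightarrow> Min (F S) \<le> k \<Longrightarrow> k \<le> Max (F S) \<Longrightarrow> k \<in> F S"
  by (rule feasible_convex[of "Min (F S)" S "Max (F S)"]) (auto simp: finite_feasible)

lemma feasible_Min_le_Max: "F S \<noteq> {} \<Longrightarrow> Min (F S) \<le> Max (F S)"
  using finite_feasible by (meson Max_ge Min_in)

lemma feasible_empty_sample: "F {} = {eps c..T}"
  by (auto simp: feasible_iff consistent_def)

end

section \<open>Legality of the rules that select a feasible cutoff\<close>

context setting
begin

lemma cutoff_rule_legal:
  assumes "\<And>l u. l \<le> u \<Longrightarrow> l \<le> f l u \<and> f l u \<le> u"
  shows "legal_oracle c s xs (cutoff_rule c s xs f)"
  unfolding legal_oracle_def
proof (intro allI impI, elim conjE)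
  fix r and S :: "'a sample"
  assume "admissible c s xs r"
  then interpret ordered_setting c s xs r by unfold_locales
  show "case cutoff_rule c s xs f S r of
      None \<Rightarrow> \<not> (\<exists>h \<in> C. consistent h S) | Some h \<Rightarrow> h \<in> C \<and> consistent h S"
  proof (cases "F S = {}")
    case True
    then show ?thesis
      using feasible_empty_iff by (simp add: cutoff_rule_def)
  next
    case False
    then have "f (Min (F S)) (Max (F S)) \<in> F S"
      using assms feasible_Min_le_Max feasible_between by blast
    moreover from this have "f (Min (F S)) (Max (F S)) \<in> {eps c..T}" by (simp add: feasible_iff)
    note prefix_in_concepts[OF this]
    ultimately show ?thesis
      using False unfolding cutoff_rule_def Let_def feasible_iff by simp
  qed
qed

lemma feasible_median_legal: "legal_oracle c s xs (feasible_median_rule c s xs)"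
  unfolding feasible_median_rule_def by (rule cutoff_rule_legal) auto

lemma global_median_legal: "legal_oracle c s xs (global_median_rule c s xs)"
  unfolding global_median_rule_def by (rule cutoff_rule_legal) auto

end

section \<open>Rules selecting the feasible cutoff nearest to a fixed one\<close>

text \<open>On an interval this is \<open>m\<close> clamped to it: either \<open>v = m\<close>, or
  all of \<open>A\<close> lies on one side of \<open>m\<close> and \<open>v\<close> is the end
  facing \<open>m\<close>. Stated without \<open>Min\<close> and \<open>Max\<close>, it restricts
  well to subsets.\<close>

definition nearest :: "nat \<Rightarrow> nat set \<Rightarrow> nat \<Rightarrow> bool" where
  "nearest m A v \<longleftrightarrow> v \<in> A \<and> (\<forall>k\<in>A. (v < m \<longrightarrow> k \<le> v) \<and> (m < v \<longrightarrow> v \<le> k))"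

lemma nearest_unique: "nearest m A v \<Longrightarrow> nearest m A w \<Longrightarrow> v = w"
proof (induction v w rule: linorder_wlog)
  case (le v w)
  then have "v < m \<longrightarrow> w \<le> v" "m < w \<longrightarrow> w \<le> v"
    by (auto simp: nearest_def)
  with le(1) show ?case by linarith
qed simp

text \<open>The selected value can be found inside the window: if \<open>m\<close> and some
  \<open>k\<close> of \<open>A\<close> lie in it, then \<open>v\<close> lies between
  \<open>m\<close> and \<open>k\<close>.\<close>

lemma nearest_window:
  assumes "nearest m A v" "A \<subseteq> {lo..hi} \<or> m \<in> {lo..hi} \<and> A \<inter> {lo..hi} \<noteq> {}"
  shows "nearest m (A \<inter> {lo..hi}) v"
proof -
  have "v \<in> {lo..hi}"
    using assms(2)
  proof
    assume "m \<in> {lo..hi} \<and> A \<inter> {lo..hi} \<noteq> {}"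
    then obtain k where k: "k \<in> A" "lo \<le> k" "k \<le> hi" "lo \<le> m" "m \<le> hi" by auto
    then have "v < m \<longrightarrow> k \<le> v" "m < v \<longrightarrow> v \<le> k"
      using assms(1) by (auto simp: nearest_def)
    with k show ?thesis by (cases v m rule: linorder_cases) auto
  qed (use assms(1) in \<open>auto simp: nearest_def\<close>)
  with assms(1) show ?thesis by (auto simp: nearest_def)
qed

definition nearest_rule :: "convention \<Rightarrow> 'a \<Rightarrow> 'a list \<Rightarrow> nat \<Rightarrow> 'a rule \<Rightarrow> bool" where
  "nearest_rule c s xs m R \<longleftrightarrow> (\<forall>r S. admissible c s xs r \<longrightarrow>
     (let F = feasible_cutoffs c s xs S r in
       if F = {} then R S r = None
       else \<exists>v. nearest m F v \<and> R S r = Some (prefix_concept c s xs r v)))"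

context setting
begin

lemma cutoff_rule_nearest:
  assumes "\<And>r S. admissible c s xs r \<Longrightarrow> feasible_cutoffs c s xs S r \<noteq> {} \<Longrightarrow>
    nearest m (feasible_cutoffs c s xs S r)
      (f (Min (feasible_cutoffs c s xs S r)) (Max (feasible_cutoffs c s xs S r)))"
  shows "nearest_rule c s xs m (cutoff_rule c s xs f)"
  using assms by (auto simp: nearest_rule_def cutoff_rule_def Let_def)

lemma smallest_nearest: "nearest_rule c s xs (eps c) (smallest_rule c s xs)"
  unfolding smallest_rule_def
proof (rule cutoff_rule_nearest)
  fix r S
  assume "admissible c s xs r"
  then interpret ordered_setting c s xs r by unfold_locales
  assume "F S \<noteq> {}"
  then have "Min (F S) \<in> F S" "\<forall>k\<in>F S. Min (F S) \<le> k"
    using finite_feasible by auto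
  then show "nearest (eps c) (F S) (Min (F S))"
    by (auto simp: nearest_def feasible_iff)
qed

lemma largest_nearest: "nearest_rule c s xs T (largest_rule c s xs)"
  unfolding largest_rule_def
proof (rule cutoff_rule_nearest)
  fix r S
  assume "admissible c s xs r"
  then interpret ordered_setting c s xs r by unfold_locales
  assume "F S \<noteq> {}"
  then have "Max (F S) \<in> F S" "\<forall>k\<in>F S. k \<le> Max (F S)"
    using finite_feasible by auto
  then show "nearest T (F S) (Max (F S))"
    by (auto simp: nearest_def feasible_iff)
qed

lemma global_median_nearest:
  "nearest_rule c s xs (global_median c xs) (global_median_rule c s xs)"
  unfolding global_median_rule_def
proof (rule cutoff_rule_nearest)
  fix r S
  assume "admissible c s xs r"
  then interpret ordered_setting c s xs r by unfold_locales
  assume ne: "F S \<noteq> {}"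
  define v where "v = min (Max (F S)) (max (Min (F S)) (global_median c xs))"
  have "Min (F S) \<le> Max (F S)" using ne by (rule feasible_Min_le_Max)
  then have "v \<in> F S" using ne feasible_between[of S v] by (auto simp: v_def)
  moreover have "\<forall>k\<in>F S. Min (F S) \<le> k \<and> k \<le> Max (F S)"
    using finite_feasible by auto
  ultimately show "nearest (global_median c xs) (F S)
      (min (Max (F S)) (max (Min (F S)) (global_median c xs)))"
    unfolding v_def[symmetric] nearest_def by (auto simp: v_def)
qed

text \<open>Feasibility of a cutoff depends only on its prefix, so both orders have the same
  feasible cutoffs in the window. The window condition ensures that these already decide whether the
  answer is \<open>None\<close> and which cutoff is nearest to \<open>m\<close>.\<close>

lemma nearest_rule_window:
  assumes rule: "nearest_rule c s xs m R"
    and adm: "admissible c s xs r" "admissible c s xs r'"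
    and pre_eq: "\<And>k. k \<in> {lo..hi} \<Longrightarrow> prefix_concept c s xs r k = prefix_concept c s xs r' k"
    and window: "\<And>q. q \<in> {r, r'} \<Longrightarrow>
      feasible_cutoffs c s xs S q \<subseteq> {lo..hi} \<or> m \<in> {lo..hi} \<and>
        (feasible_cutoffs c s xs S q \<noteq> {} \<longrightarrow> feasible_cutoffs c s xs S q \<inter> {lo..hi} \<noteq> {})"
  shows "R S r = R S r'"
proof -
  interpret o: ordered_setting c s xs r using adm by unfold_locales
  interpret o': ordered_setting c s xs r' using adm by unfold_locales
  let ?J = "{lo..hi}"
  have eq: "o.F S \<inter> ?J = o'.F S \<inter> ?J"
    using pre_eq by (auto simp: o.feasible_iff o'.feasible_iff)
  have empty: "o.F S = {} \<longleftrightarrow> o.F S \<inter> ?J = {}" "o'.F S = {} \<longleftrightarrow> o'.F S \<inter> ?J = {}"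
    using window by blast+
  show ?thesis
  proof (cases "o.F S = {}")
    case True
    then show ?thesis
      using rule adm empty eq by (simp add: nearest_rule_def Let_def)
  next
    case False
    then have False': "o'.F S \<noteq> {}" using empty eq by simp
    obtain v where v: "nearest m (o.F S) v" "R S r = Some (o.pre v)"
      using rule adm False unfolding nearest_rule_def Let_def by metis
    obtain w where w: "nearest m (o'.F S) w" "R S r' = Some (o'.pre w)"
      using rule adm False' unfolding nearest_rule_def Let_def by metis
    have nv: "nearest m (o.F S \<inter> ?J) v"
      by (rule nearest_window[OF v(1)]) (use window[of r] False in blast)
    have nw: "nearest m (o'.F S \<inter> ?J) w"
      by (rule nearest_window[OF w(1)]) (use window[of r'] False' in blast)
    have "v = w" using nv nw nearest_unique unfolding eq by blast
    moreover have "v \<in> ?J" using nv by (auto simp: nearest_def)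
    ultimately show ?thesis using v w pre_eq by simp
  qed
qed

end

section \<open>Orders given by lists\<close>

text \<open>Smallest element first, so the positive sets of thresholds are initial segments of
  \<open>l\<close>.\<close>

definition list_order :: "'a list \<Rightarrow> 'a rel" where
  "list_order l = {(l ! i, l ! j) | i j. i \<le> j \<and> j < length l}"

lemma list_order_iff:
  assumes "distinct l" "j < length l"
  shows "(x, l ! j) \<in> list_order l \<longleftrightarrow> x \<in> set (take (Suc j) l)"
proof -
  have "(x, l ! j) \<in> list_order l \<longleftrightarrow> (\<exists>i\<le>j. x = l ! i)"
    using assms by (auto simp: list_order_def nth_eq_iff_index_eq)
  also have "\<dots> \<longleftrightarrow> x \<in> set (take (Suc j) l)"
    using assms(2) by (auto simp: in_set_conv_nth less_Suc_eq_le)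
  finally show ?thesis .
qed

lemma list_order_nth_iff:
  assumes "distinct l" "i < length l" "j < length l"
  shows "(l ! i, l ! j) \<in> list_order l \<longleftrightarrow> i \<le> j"
  using assms by (auto simp: list_order_def nth_eq_iff_index_eq)

lemma linear_order_list_order:
  assumes "distinct l"
  shows "linear_order_on (set l) (list_order l)"
  unfolding order_on_defs
proof (intro conjI)
  show "list_order l \<subseteq> set l \<times> set l" by (auto simp: list_order_def)
  show "refl_on (set l) (list_order l)"
    using assms list_order_nth_iff by (fastforce simp: refl_on_def in_set_conv_nth)
  show "trans (list_order l)"
  proof (rule transI)
    fix x y z
    assume "(x, y) \<in> list_order l" "(y, z) \<in> list_order l"
    moreover from this obtain i j k where "x = l ! i" "y = l ! j" "z = l ! k"
        "i < length l" "j < length l" "k < length l"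
      by (fastforce simp: list_order_def)
    ultimately show "(x, z) \<in> list_order l" using assms by (simp add: list_order_nth_iff)
  qed
  show "antisym (list_order l)"
  proof (rule antisymI)
    fix x y
    assume "(x, y) \<in> list_order l" "(y, x) \<in> list_order l"
    moreover from this obtain i j where "x = l ! i" "y = l ! j" "i < length l" "j < length l"
      by (fastforce simp: list_order_def)
    ultimately show "x = y" using assms by (simp add: list_order_nth_iff)
  qed
  show "total_on (set l) (list_order l)"
  proof (rule total_onI)
    fix x y
    assume "x \<in> set l" "y \<in> set l"
    then obtain i j where "x = l ! i" "y = l ! j" "i < length l" "j < length l"
      by (auto simp: in_set_conv_nth)
    then show "(x, y) \<in> list_order l \<or> (y, x) \<in> list_order l"
      using assms by (auto simp: list_order_nth_iff)
  qed
qed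

definition enumerates :: "'a list \<Rightarrow> 'a set \<Rightarrow> bool" where
  "enumerates l A \<longleftrightarrow> distinct l \<and> set l = A"

lemma enumerates_ex: "finite A \<Longrightarrow> \<exists>l. enumerates l A"
  unfolding enumerates_def using finite_distinct_list by blast

lemma enumerates_length: "enumerates l A \<Longrightarrow> length l = card A"
  unfolding enumerates_def using distinct_card by fastforce

section \<open>Admissible orders given by lists, and their prefixes\<close>

context setting
begin

definition valid :: "'a list \<Rightarrow> bool" where
  "valid l \<longleftrightarrow> enumerates l X \<and> (c = ConvE \<longrightarrow> hd l = s)"

lemma valid_length: "valid l \<Longrightarrow> length l + eps c = Suc T"
  using card_points enumerates_length by (fastforce simp: valid_def)

lemma valid_nonempty: "valid l \<Longrightarrow> l \<noteq> []"
  using valid_length eps_le by fastforce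

lemma list_order_admissible:
  assumes "valid l"
  shows "admissible c s xs (list_order l)"
proof -
  have l: "distinct l" "set l = X" using assms by (auto simp: valid_def enumerates_def)
  have "(s, x) \<in> list_order l" if "c = ConvE" "x \<in> X" for x
  proof -
    have "hd l = s" using assms that(1) unfolding valid_def by blast
    then have "s = l ! 0" using valid_nonempty[OF assms] by (simp add: hd_conv_nth)
    moreover obtain j where "x = l ! j" "j < length l"
      using \<open>x \<in> X\<close> l by (metis in_set_conv_nth)
    ultimately show ?thesis using list_order_nth_iff[OF l(1), of 0 j] valid_nonempty[OF assms] by simp
  qed
  then show ?thesis
    using linear_order_list_order[OF l(1)] l(2) by (simp add: admissible_def)
qed

lemma threshold_list_order:
  assumes "valid l" "0 < j" "j \<le> length l"
  shows "threshold (list_order l) (l ! (j - 1)) = (\<lambda>x. x \<in> set (take j l))"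
  using list_order_iff[of l "j - 1"] assms by (auto simp: threshold_def valid_def enumerates_def)

text \<open>Under \<open>ConvE\<close> the sentinel at the head is positive but not counted, so the
  prefix takes \<open>k + 1\<close> list elements; under \<open>ConvN\<close> it takes
  \<open>k\<close>.\<close>

lemma prefix_list_order:
  assumes l: "valid l" and k: "k \<in> {eps c..T}"
  shows "prefix_concept c s xs (list_order l) k = (\<lambda>x. x \<in> set (take (Suc k - eps c) l))"
proof -
  interpret ordered_setting c s xs "list_order l"
    using l list_order_admissible by unfold_locales
  define j where "j = Suc k - eps c"
  define D where "D = (\<lambda>x. x \<in> set (take j l))"
  have j: "0 < j" "j \<le> length l" using valid_length[OF l] k by (auto simp: j_def)
  have dist: "distinct l" "set l = X" using l by (auto simp: valid_def enumerates_def)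
  have "l ! (j - 1) \<in> X" using dist j by (metis diff_less less_le_trans nth_mem zero_less_one)
  then have DC: "D \<in> C"
    unfolding concepts_def D_def threshold_list_order[OF l j, symmetric] by blast
  have card_take: "card (set (take j l)) = j"
    using dist j by (simp add: distinct_card)
  have sub: "set (take j l) \<subseteq> X" using dist set_take_subset by metis
  have "pos_count D = k"
  proof (cases c)
    case ConvE
    then have "hd l = s" using l unfolding valid_def by blast
    then have s: "s \<in> set (take j l)"
      using j valid_nonempty[OF l] by (cases l; cases j) simp_all
    have "{x \<in> set xs. D x} = set (take j l) - {s}"
      using sub ann ConvE by (auto simp: D_def points_def announced_def)
    then show ?thesis
      using card_take s ConvE by (simp add: cutoff_def j_def)
  next
    case ConvN
    then have "{x \<in> set xs. D x} = set (take j l)"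
      using sub by (auto simp: D_def points_def)
    then show ?thesis using card_take ConvN k by (simp add: cutoff_def j_def)
  qed
  with prefix_cutoff[OF DC] show ?thesis by (simp add: D_def j_def)
qed

section \<open>The adversary\<close>

text \<open>
  The adversary has committed to a bottom segment \<open>bs\<close> labelled \<open>True\<close> and a top segment \<open>ts\<close>
  labelled \<open>False\<close>; nothing is fixed about the elements of \<open>U\<close> in between.
\<close>

definition config :: "'a list \<Rightarrow> 'a set \<Rightarrow> 'a list \<Rightarrow> bool" where
  "config bs U ts \<longleftrightarrow> bs \<noteq> [] \<and> distinct (bs @ ts) \<and> set (bs @ ts) \<inter> U = {} \<and>
     set (bs @ ts) \<union> U = X \<and> (c = ConvE \<longrightarrow> hd bs = s)"

text \<open>An answer with this property can be given while the order inside \<open>U\<close> is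
  still open.\<close>

definition determined :: "'a rule \<Rightarrow> 'a sample \<Rightarrow> 'a list \<Rightarrow> 'a set \<Rightarrow> 'a list \<Rightarrow> bool" where
  "determined R S bs U ts \<longleftrightarrow> (\<forall>us us'. enumerates us U \<longrightarrow> enumerates us' U \<longrightarrow>
     R S (list_order (bs @ us @ ts)) = R S (list_order (bs @ us' @ ts)))"

lemma config_snoc: "config bs U ts \<Longrightarrow> a \<in> U \<Longrightarrow> config (bs @ [a]) (U - {a}) ts"
  and config_cons: "config bs U ts \<Longrightarrow> a \<in> U \<Longrightarrow> config bs (U - {a}) (a # ts)"
  by (auto simp: config_def)

lemma config_finite: "config bs U ts \<Longrightarrow> finite U"
  using finite_points by (auto simp: config_def intro: finite_subset)

lemma config_valid: "config bs U ts \<Longrightarrow> enumerates us U \<Longrightarrow> valid (bs @ us @ ts)"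
  by (auto simp: config_def valid_def enumerates_def)

lemma config_length:
  assumes "config bs U ts"
  shows "length bs + card U + length ts + eps c = Suc T"
proof -
  obtain us where us: "enumerates us U" using enumerates_ex config_finite assms by blast
  show ?thesis
    using valid_length[OF config_valid[OF assms us]] enumerates_length[OF us] by simp
qed

text \<open>These are the cutoffs of the prefixes whose positive sets are exactly \<open>bs\<close>,
  and \<open>bs\<close> together with \<open>U\<close>. Truncated subtraction is harmless since
  \<open>bs\<close> is nonempty.\<close>

lemma config_low_cutoff:
  assumes "config bs U ts"
  shows "length bs + eps c - 1 \<in> {eps c..T}" "Suc (length bs + eps c - 1) - eps c = length bs"
  and config_high_cutoff: "length bs + card U + eps c - 1 \<in> {eps c..T}"
    "Suc (length bs + card U + eps c - 1) - eps c = length bs + card U"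
proof -
  have "0 < length bs" using assms by (simp add: config_def)
  with config_length[OF assms]
  show "length bs + eps c - 1 \<in> {eps c..T}" "Suc (length bs + eps c - 1) - eps c = length bs"
    "length bs + card U + eps c - 1 \<in> {eps c..T}"
    "Suc (length bs + card U + eps c - 1) - eps c = length bs + card U"
    unfolding atLeastAtMost_iff by linarith+
qed

text \<open>The initial segment ends before \<open>U\<close>, so the arrangement \<open>us\<close>
  does not enter; in \<open>config_prefix_high\<close> it swallows \<open>U\<close> as a
  whole.\<close>

lemma config_prefix_low:
  assumes "config bs U ts" "enumerates us U" "k \<in> {eps c..length bs + eps c - 1}"
  shows "prefix_concept c s xs (list_order (bs @ us @ ts)) k =
    (\<lambda>x. x \<in> set (take (Suc k - eps c) bs))"
proof -
  have "k \<in> {eps c..T}" "Suc k - eps c \<le> length bs"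
    using assms(3) config_low_cutoff[OF assms(1)] unfolding atLeastAtMost_iff by linarith+
  then show ?thesis
    using prefix_list_order[OF config_valid[OF assms(1,2)]] by simp
qed

lemma config_prefix_high:
  assumes "config bs U ts" "enumerates us U" "k \<in> {length bs + card U + eps c - 1..T}"
  shows "prefix_concept c s xs (list_order (bs @ us @ ts)) k =
    (\<lambda>x. x \<in> set bs \<union> U \<union> set (take (Suc k - eps c - (length bs + card U)) ts))"
proof -
  have k: "k \<in> {eps c..T}" "length bs + card U \<le> Suc k - eps c"
    using assms(3) config_high_cutoff[OF assms(1)] unfolding atLeastAtMost_iff by linarith+
  moreover have "length us = card U" "set us = U"
    using assms(2) enumerates_length by (auto simp: enumerates_def)
  ultimately show ?thesis
    using prefix_list_order[OF config_valid[OF assms(1,2)] k(1)]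
    by (auto simp: ac_simps)
qed

text \<open>The two windows consist of the cutoffs whose prefixes are blind to the arrangement of
  \<open>U\<close>, so \<open>nearest_rule_window\<close> applies to any two arrangements.\<close>

lemma determined_window:
  assumes cfg: "config bs U ts" and rule: "nearest_rule c s xs m R"
    and J: "{lo..hi} = {eps c..length bs + eps c - 1} \<or>
      {lo..hi} = {length bs + card U + eps c - 1..T}"
    and window: "\<And>us. enumerates us U \<Longrightarrow>
      (let F = feasible_cutoffs c s xs S (list_order (bs @ us @ ts)) in
        F \<subseteq> {lo..hi} \<or> m \<in> {lo..hi} \<and> (F \<noteq> {} \<longrightarrow> F \<inter> {lo..hi} \<noteq> {}))"
  shows "determined R S bs U ts"
  unfolding determined_def
proof (intro allI impI)
  fix us us'
  assume us: "enumerates us U" "enumerates us' U"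
  show "R S (list_order (bs @ us @ ts)) = R S (list_order (bs @ us' @ ts))"
  proof (intro nearest_rule_window[OF rule, of _ _ lo hi])
    show "prefix_concept c s xs (list_order (bs @ us @ ts)) k =
        prefix_concept c s xs (list_order (bs @ us' @ ts)) k" if "k \<in> {lo..hi}" for k
      using J
    proof
      assume "{lo..hi} = {eps c..length bs + eps c - 1}"
      with that have "k \<in> {eps c..length bs + eps c - 1}" by blast
      then show ?thesis using config_prefix_low[OF cfg] us by simp
    next
      assume "{lo..hi} = {length bs + card U + eps c - 1..T}"
      with that have "k \<in> {length bs + card U + eps c - 1..T}" by blast
      then show ?thesis using config_prefix_high[OF cfg] us by simp
    qed
  qed (use us window config_valid[OF cfg] list_order_admissible in \<open>auto simp: Let_def\<close>)
qed

text \<open>Lowering a larger feasible cutoff to that of \<open>bs\<close> keeps it feasible: the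
  positives lie in \<open>bs\<close>, and negatives stay negative. So a nonempty feasible set meets
  the lower window, which contains \<open>m\<close>.\<close>

lemma determined_positive_low:
  assumes cfg: "config bs U ts" and rule: "nearest_rule c s xs m R"
    and m: "eps c \<le> m" "m < length bs + eps c"
    and S: "\<And>x. (x, True) \<in> S \<Longrightarrow> x \<in> set bs"
  shows "determined R S bs U ts"
proof (rule determined_window[OF cfg rule])
  define b where "b = length bs + eps c - 1"
  fix us
  assume us: "enumerates us U"
  interpret ordered_setting c s xs "list_order (bs @ us @ ts)"
    using config_valid[OF cfg us] list_order_admissible by unfold_locales
  have b: "b \<in> {eps c..T}" using config_low_cutoff[OF cfg] by (simp add: b_def)
  have pre_b: "pre b = (\<lambda>x. x \<in> set bs)"
    using config_prefix_low[OF cfg us, of b] b config_low_cutoff(2)[OF cfg] by (simp add: b_def)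
  have "F S \<inter> {eps c..b} \<noteq> {}" if "k \<in> F S" for k
  proof (cases "k \<le> b")
    case True
    with that show ?thesis by (auto simp: feasible_iff)
  next
    case False
    have k: "k \<in> {eps c..T}" "consistent (pre k) S" using that by (auto simp: feasible_iff)
    have "pre b x = y" if "(x, y) \<in> S" for x y
    proof (cases y)
      case True
      with that S pre_b show ?thesis by auto
    next
      case y: False
      then have "\<not> pre k x" using that k(2) by (auto simp: consistent_def)
      then show ?thesis using y prefix_mono[OF b k(1)] False by auto
    qed
    then have "b \<in> F S" using b by (auto simp: feasible_iff consistent_def)
    then show ?thesis using b by auto
  qed
  moreover have "m \<in> {eps c..b}" using m by (auto simp: b_def)
  ultimately show "let F = F S in F \<subseteq> {eps c..length bs + eps c - 1} \<or>
      m \<in> {eps c..length bs + eps c - 1} \<and>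
        (F \<noteq> {} \<longrightarrow> F \<inter> {eps c..length bs + eps c - 1} \<noteq> {})"
    unfolding b_def[symmetric] Let_def by blast
qed simp

text \<open>A positive in \<open>ts\<close> forces every consistent prefix past \<open>U\<close>, so
  all feasible cutoffs lie in the upper window, wherever \<open>m\<close> is.\<close>

lemma determined_positive_high:
  assumes cfg: "config bs U ts" and rule: "nearest_rule c s xs m R"
    and x: "(x, True) \<in> S" "x \<in> set ts"
  shows "determined R S bs U ts"
proof (rule determined_window[OF cfg rule])
  define b where "b = length bs + card U + eps c - 1"
  fix us
  assume us: "enumerates us U"
  interpret ordered_setting c s xs "list_order (bs @ us @ ts)"
    using config_valid[OF cfg us] list_order_admissible by unfold_locales
  have b: "b \<in> {eps c..T}" using config_high_cutoff[OF cfg] by (simp add: b_def)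
  have pre_b: "pre b = (\<lambda>x. x \<in> set bs \<union> U)"
    using config_prefix_high[OF cfg us, of b] b config_high_cutoff(2)[OF cfg] by (simp add: b_def)
  have "b \<le> k" if "k \<in> F S" for k
  proof (rule ccontr)
    assume "\<not> b \<le> k"
    moreover have k: "k \<in> {eps c..T}" "pre k x"
      using that x(1) by (auto simp: feasible_iff consistent_def)
    ultimately have "pre b x" using prefix_mono[OF k(1) b] by simp
    with pre_b x(2) cfg show False by (auto simp: config_def)
  qed
  then show "let F = F S in F \<subseteq> {length bs + card U + eps c - 1..T} \<or>
      m \<in> {length bs + card U + eps c - 1..T} \<and>
        (F \<noteq> {} \<longrightarrow> F \<inter> {length bs + card U + eps c - 1..T} \<noteq> {})"
    unfolding b_def[symmetric] Let_def by (auto simp: feasible_iff)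
qed simp

text \<open>Dual to \<open>determined_positive_low\<close>: raising a smaller feasible cutoff to
  that of \<open>bs\<close> with \<open>U\<close> adds positives only where the sample has no
  negatives, and \<open>T\<close> always lies in the upper window.\<close>

lemma determined_negative_high:
  assumes cfg: "config bs U ts" and rule: "nearest_rule c s xs T R"
    and S: "\<And>x. (x, False) \<in> S \<Longrightarrow> x \<notin> set bs \<union> U"
  shows "determined R S bs U ts"
proof (rule determined_window[OF cfg rule])
  define b where "b = length bs + card U + eps c - 1"
  fix us
  assume us: "enumerates us U"
  interpret ordered_setting c s xs "list_order (bs @ us @ ts)"
    using config_valid[OF cfg us] list_order_admissible by unfold_locales
  have b: "b \<in> {eps c..T}" using config_high_cutoff[OF cfg] by (simp add: b_def)
  have pre_b: "pre b = (\<lambda>x. x \<in> set bs \<union> U)"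
    using config_prefix_high[OF cfg us, of b] b config_high_cutoff(2)[OF cfg] by (simp add: b_def)
  have "F S \<inter> {b..T} \<noteq> {}" if "k \<in> F S" for k
  proof (cases "b \<le> k")
    case True
    with that show ?thesis by (auto simp: feasible_iff)
  next
    case False
    have k: "k \<in> {eps c..T}" "consistent (pre k) S" using that by (auto simp: feasible_iff)
    have "pre b x = y" if "(x, y) \<in> S" for x y
    proof (cases y)
      case True
      then have "pre k x" using that k(2) by (auto simp: consistent_def)
      then show ?thesis using True prefix_mono[OF k(1) b] False by auto
    next
      case y: False
      with that S pre_b show ?thesis by auto
    qed
    then have "b \<in> F S" using b by (auto simp: feasible_iff consistent_def)
    then show ?thesis using b by auto
  qed
  then show "let F = F S in F \<subseteq> {length bs + card U + eps c - 1..T} \<or>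
      T \<in> {length bs + card U + eps c - 1..T} \<and>
        (F \<noteq> {} \<longrightarrow> F \<inter> {length bs + card U + eps c - 1..T} \<noteq> {})"
    using b unfolding b_def[symmetric] Let_def by auto
qed simp

text \<open>Dual to \<open>determined_positive_high\<close>: a negative in \<open>bs\<close> keeps
  all feasible cutoffs in the lower window.\<close>

lemma determined_negative_low:
  assumes cfg: "config bs U ts" and rule: "nearest_rule c s xs m R"
    and x: "(x, False) \<in> S" "x \<in> set bs"
  shows "determined R S bs U ts"
proof (rule determined_window[OF cfg rule])
  define b where "b = length bs + eps c - 1"
  fix us
  assume us: "enumerates us U"
  interpret ordered_setting c s xs "list_order (bs @ us @ ts)"
    using config_valid[OF cfg us] list_order_admissible by unfold_locales
  have b: "b \<in> {eps c..T}" using config_low_cutoff[OF cfg] by (simp add: b_def)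
  have pre_b: "pre b = (\<lambda>x. x \<in> set bs)"
    using config_prefix_low[OF cfg us, of b] b config_low_cutoff(2)[OF cfg] by (simp add: b_def)
  have "k \<le> b" if "k \<in> F S" for k
  proof (rule ccontr)
    assume "\<not> k \<le> b"
    moreover have k: "k \<in> {eps c..T}" "\<not> pre k x"
      using that x(1) by (auto simp: feasible_iff consistent_def)
    ultimately have "\<not> pre b x" using prefix_mono[OF b k(1)] by auto
    with pre_b x(2) show False by simp
  qed
  then show "let F = F S in F \<subseteq> {eps c..length bs + eps c - 1} \<or>
      m \<in> {eps c..length bs + eps c - 1} \<and>
        (F \<noteq> {} \<longrightarrow> F \<inter> {eps c..length bs + eps c - 1} \<noteq> {})"
    unfolding b_def[symmetric] Let_def by (auto simp: feasible_iff)
qed simp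

end

section \<open>The adversary argument and the resulting lower bounds\<close>

context setting
begin

text \<open>What the adversary may still end up with: the threshold can fall anywhere in
  \<open>U\<close>, with \<open>us\<close> below it and \<open>vs\<close> above.\<close>

definition outcomes :: "'a list \<Rightarrow> 'a set \<Rightarrow> 'a list \<Rightarrow> ('a rel \<times> ('a \<Rightarrow> bool)) set" where
  "outcomes bs U ts = {(list_order (bs @ us @ vs @ ts), \<lambda>x. x \<in> set (bs @ us)) | us vs.
     enumerates (us @ vs) U}"

lemma outcomes_ex: "finite U \<Longrightarrow> \<exists>r. (r, \<lambda>x. x \<in> set bs \<union> U) \<in> outcomes bs U ts"
proof -
  assume "finite U"
  then obtain us where "enumerates us U" using enumerates_ex by blast
  then show ?thesis
    unfolding outcomes_def enumerates_def
    by (intro exI[of _ "list_order (bs @ us @ [] @ ts)"] CollectI exI[of _ us] exI[of _ "[]"]) auto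
qed

text \<open>The moved element becomes the first of \<open>us\<close>; in
  \<open>outcomes_cons\<close> it becomes the last of \<open>vs\<close>. Committing thus only
  discards possibilities.\<close>

lemma outcomes_snoc:
  assumes "a \<in> U"
  shows "outcomes (bs @ [a]) (U - {a}) ts \<subseteq> outcomes bs U ts"
proof
  fix p
  assume "p \<in> outcomes (bs @ [a]) (U - {a}) ts"
  then obtain us vs where p: "enumerates (us @ vs) (U - {a})"
      "p = (list_order (bs @ (a # us) @ vs @ ts), \<lambda>x. x \<in> set (bs @ (a # us)))"
    by (auto simp: outcomes_def)
  moreover from p assms have "enumerates ((a # us) @ vs) U" by (auto simp: enumerates_def)
  ultimately show "p \<in> outcomes bs U ts" unfolding outcomes_def by blast
qed

lemma outcomes_cons:
  assumes "a \<in> U"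
  shows "outcomes bs (U - {a}) (a # ts) \<subseteq> outcomes bs U ts"
proof
  fix p
  assume "p \<in> outcomes bs (U - {a}) (a # ts)"
  then obtain us vs where p: "enumerates (us @ vs) (U - {a})"
      "p = (list_order (bs @ us @ (vs @ [a]) @ ts), \<lambda>x. x \<in> set (bs @ us))"
    by (auto simp: outcomes_def)
  moreover from p assms have "enumerates (us @ (vs @ [a])) U" by (auto simp: enumerates_def)
  ultimately show "p \<in> outcomes bs U ts" unfolding outcomes_def by blast
qed

lemma outcomes_label: "(r, h) \<in> outcomes bs U ts \<Longrightarrow> x \<notin> U \<Longrightarrow> h x \<longleftrightarrow> x \<in> set bs"
  by (auto simp: outcomes_def enumerates_def)

lemma outcomes_determined:
  assumes "determined R S bs U ts" "(r, h) \<in> outcomes bs U ts" "(r', h') \<in> outcomes bs U ts"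
  shows "R S r = R S r'"
proof -
  obtain us vs us' vs' where "enumerates (us @ vs) U" "enumerates (us' @ vs') U"
      "r = list_order (bs @ (us @ vs) @ ts)" "r' = list_order (bs @ (us' @ vs') @ ts)"
    using assms(2,3) by (auto simp: outcomes_def)
  then show ?thesis using assms(1) unfolding determined_def by blast
qed

text \<open>The target is the last element of \<open>bs @ us\<close>, which exists even for empty
  \<open>us\<close> because \<open>bs\<close> is nonempty.\<close>

lemma outcomes_instance:
  assumes cfg: "config bs U ts" and rh: "(r, h) \<in> outcomes bs U ts"
  obtains z where "(r, z) \<in> problem_instances c s xs" "threshold r z = h"
proof -
  obtain us vs where us: "enumerates (us @ vs) U" "r = list_order (bs @ us @ vs @ ts)"
      "h = (\<lambda>x. x \<in> set (bs @ us))"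
    using rh by (auto simp: outcomes_def)
  define l where "l = bs @ us @ vs @ ts"
  define j where "j = length (bs @ us)"
  have l: "valid l" using config_valid[OF cfg us(1)] by (simp add: l_def)
  have j: "0 < j" "j \<le> length l" using cfg by (auto simp: j_def l_def config_def)
  have "set l = X" using l by (simp add: valid_def enumerates_def)
  moreover have "l ! (j - 1) \<in> set l" using j by simp
  ultimately have "(r, l ! (j - 1)) \<in> problem_instances c s xs"
    using list_order_admissible[OF l] us(2) by (simp add: problem_instances_def l_def)
  moreover have "threshold r (l ! (j - 1)) = h"
    using threshold_list_order[OF l j] us(2,3) by (simp add: l_def j_def)
  ultimately show ?thesis by (rule that)
qed

text \<open>
  A wrong prediction and an oracle call each let the adversary off with moving at most one
  element out of \<open>U\<close>, to the segment that makes the learner err or that fixes the answer.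
\<close>

lemma adversary:
  assumes step: "\<And>bs U ts S. Inv bs U ts \<Longrightarrow> S \<subseteq> X \<times> UNIV \<Longrightarrow>
      determined R S bs U ts \<or> (\<exists>a\<in>U. determined R S (bs @ [a]) (U - {a}) ts) \<or>
      (\<exists>a\<in>U. determined R S bs (U - {a}) (a # ts))"
    and snoc: "\<And>bs U ts a. Inv bs U ts \<Longrightarrow> a \<in> U \<Longrightarrow> Inv (bs @ [a]) (U - {a}) ts"
    and cons: "\<And>bs U ts a. Inv bs U ts \<Longrightarrow> a \<in> U \<Longrightarrow> Inv bs (U - {a}) (a # ts)"
  shows "Inv bs U ts \<Longrightarrow> finite U \<Longrightarrow> set bs \<inter> U = {} \<Longrightarrow> queries_within X L \<Longrightarrow> U \<subseteq> set ys \<Longrightarrow>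
    \<exists>(r, h)\<in>outcomes bs U ts. card U \<le> mistakes L (\<lambda>S. R S r) h ys + calls L (\<lambda>S. R S r) h ys"
proof (induction L arbitrary: bs U ts ys)
  case Halt
  \<comment> \<open>\<open>Halt\<close> predicts \<open>False\<close> forever, so labelling all of
    \<open>U\<close> positive makes every element of \<open>U\<close> a mistake.\<close>
  obtain r where r: "(r, \<lambda>x. x \<in> set bs \<union> U) \<in> outcomes bs U ts"
    using outcomes_ex Halt.prems(2) by blast
  have "card U \<le> card (set (filter (\<lambda>x. x \<in> set bs \<union> U) ys))"
    using Halt.prems by (intro card_mono) auto
  also have "\<dots> \<le> length (filter (\<lambda>x. x \<in> set bs \<union> U) ys)" by (rule card_length)
  finally show ?case using r by (intro bexI[OF _ r]) simp
next
  case (Query S k)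
  \<comment> \<open>The call pays for at most one element lost from \<open>U\<close>. Its answer is
    computed from an arbitrary outcome \<open>r0\<close>, before the rest of the run is known;
    determinacy transfers it to the outcome \<open>r\<close> supplied by the induction
    hypothesis.\<close>
  have IH: ?case
    if "Inv bs' U' ts'" "U' \<subseteq> U" "set bs' \<inter> U' = {}" "determined R S bs' U' ts'"
      "outcomes bs' U' ts' \<subseteq> outcomes bs U ts" "card U \<le> Suc (card U')" for bs' U' ts'
  proof -
    have fin: "finite U'" using that(2) Query.prems(2) by (rule finite_subset)
    obtain r0 where r0: "(r0, \<lambda>x. x \<in> set bs' \<union> U') \<in> outcomes bs' U' ts'"
      using outcomes_ex fin by blast
    have "\<exists>(r, h)\<in>outcomes bs' U' ts'.
        card U' \<le> mistakes (k (R S r0)) (\<lambda>S. R S r) h ys + calls (k (R S r0)) (\<lambda>S. R S r) h ys"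
      using that Query.prems fin by (intro Query.IH) auto
    then obtain r h where rh: "(r, h) \<in> outcomes bs' U' ts'"
        "card U' \<le> mistakes (k (R S r0)) (\<lambda>S. R S r) h ys + calls (k (R S r0)) (\<lambda>S. R S r) h ys"
      by blast
    moreover have "R S r0 = R S r" using outcomes_determined[OF that(4) r0 rh(1)] .
    ultimately show ?thesis using that(5,6) by (intro bexI[of _ "(r, h)"]) auto
  qed
  have S: "S \<subseteq> X \<times> UNIV" using Query.prems by simp
  have card: "card U \<le> Suc (card (U - {a}))" for a
    using card_Suc_Diff1[of U a] Query.prems(2) by (cases "a \<in> U") auto
  show ?case
    using step[OF Query.prems(1) S]
  proof (elim disjE bexE)
    assume "determined R S bs U ts"
    then show ?thesis by (rule IH[OF Query.prems(1) subset_refl Query.prems(3) _ subset_refl]) simp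
  next
    fix a
    assume a: "a \<in> U" "determined R S (bs @ [a]) (U - {a}) ts"
    show ?thesis
      by (rule IH[OF snoc[OF Query.prems(1) a(1)] _ _ a(2) outcomes_snoc[OF a(1)] card])
        (use Query.prems(3) in auto)
  next
    fix a
    assume a: "a \<in> U" "determined R S bs (U - {a}) (a # ts)"
    show ?thesis
      by (rule IH[OF cons[OF Query.prems(1) a(1)] _ _ a(2) outcomes_cons[OF a(1)] card])
        (use Query.prems(3) in auto)
  qed
next
  case (Predict b k)
  have IH: "\<exists>(r, h)\<in>outcomes bs' U' ts'.
      card U' \<le> mistakes (k y) (\<lambda>S. R S r) h ys' + calls (k y) (\<lambda>S. R S r) h ys'"
    if "Inv bs' U' ts'" "U' \<subseteq> U" "set bs' \<inter> U' = {}" "U' \<subseteq> set ys'" for bs' U' ts' ys' y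
    using that Predict.prems finite_subset[OF that(2)] by (intro Predict.IH) auto
  show ?case
  proof (cases ys)
    case Nil
    then have "card U = 0" using Predict.prems by simp
    then show ?thesis using outcomes_ex[OF Predict.prems(2), of bs ts] by auto
  next
    case (Cons x ys')
    show ?thesis
    proof (cases "x \<in> U")
      case False
      \<comment> \<open>The label of an element outside \<open>U\<close> is already fixed, so
        nothing moves and no cost is charged in this round.\<close>
      then have "U \<subseteq> set ys'" using Predict.prems(5) Cons by auto
      then obtain r h where rh: "(r, h) \<in> outcomes bs U ts"
          "card U \<le> mistakes (k (x \<in> set bs)) (\<lambda>S. R S r) h ys' +
            calls (k (x \<in> set bs)) (\<lambda>S. R S r) h ys'"
        using IH[of bs U ts ys' "x \<in> set bs"] Predict.prems Cons by auto
      then show ?thesis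
        using outcomes_label[OF rh(1) False] Cons by (intro bexI[OF _ rh(1)]) auto
    next
      case True
      have card: "card U = Suc (card (U - {x}))"
        using True Predict.prems(2) by (metis card_Suc_Diff1)
      have sub: "U - {x} \<subseteq> set ys'" using Predict.prems(5) Cons by auto
      show ?thesis
      proof (cases b)
        case b: True
        \<comment> \<open>A prediction \<open>True\<close> is refuted by moving \<open>x\<close> to
          the top segment; the mistake pays for the loss of \<open>x\<close> from
          \<open>U\<close>.\<close>
        obtain r h where rh: "(r, h) \<in> outcomes bs (U - {x}) (x # ts)"
            "card (U - {x}) \<le> mistakes (k False) (\<lambda>S. R S r) h ys' + calls (k False) (\<lambda>S. R S r) h ys'"
          using IH[OF cons[OF Predict.prems(1) True] _ _ sub, of False] Predict.prems(3) by blast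
        have "\<not> h x" using outcomes_label[OF rh(1), of x] True Predict.prems(3) by auto
        then show ?thesis
          using rh card b Cons outcomes_cons[OF True, of bs ts]
          by (intro bexI[of _ "(r, h)"]) auto
      next
        case b: False
        have dis: "set (bs @ [x]) \<inter> (U - {x}) = {}" using Predict.prems(3) by auto
        obtain r h where rh: "(r, h) \<in> outcomes (bs @ [x]) (U - {x}) ts"
            "card (U - {x}) \<le> mistakes (k True) (\<lambda>S. R S r) h ys' + calls (k True) (\<lambda>S. R S r) h ys'"
          using IH[OF snoc[OF Predict.prems(1) True] Diff_subset dis sub, of True] by blast
        have "h x" using outcomes_label[OF rh(1), of x] by auto
        then show ?thesis
          using rh card b Cons outcomes_snoc[OF True, of bs ts]
          by (intro bexI[of _ "(r, h)"]) auto
      qed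
    qed
  qed
qed

lemma adversary_forces:
  assumes step: "\<And>bs U ts S. Inv bs U ts \<Longrightarrow> S \<subseteq> X \<times> UNIV \<Longrightarrow>
      determined R S bs U ts \<or> (\<exists>a\<in>U. determined R S (bs @ [a]) (U - {a}) ts) \<or>
      (\<exists>a\<in>U. determined R S bs (U - {a}) (a # ts))"
    and snoc: "\<And>bs U ts a. Inv bs U ts \<Longrightarrow> a \<in> U \<Longrightarrow> Inv (bs @ [a]) (U - {a}) ts"
    and cons: "\<And>bs U ts a. Inv bs U ts \<Longrightarrow> a \<in> U \<Longrightarrow> Inv bs (U - {a}) (a # ts)"
    and init: "Inv bs U ts" "config bs U ts"
  shows "forces_total c s xs R (card U)"
  unfolding forces_total_def
proof
  fix L
  assume "L \<in> learners c s xs"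
  then have L: "queries_within X L" by (simp add: learners_def)
  have bs: "hd bs \<in> set bs" "set bs \<inter> U = {}" and U: "U \<subseteq> X"
    and hd: "c = ConvE \<longrightarrow> hd bs = s"
    using init(2) unfolding config_def by auto
  \<comment> \<open>Under \<open>ConvE\<close> the sentinel is the head of \<open>bs\<close>, so
    every element of \<open>U\<close> is announced and will be presented.\<close>
  have sub: "U \<subseteq> set xs"
  proof
    fix x
    assume "x \<in> U"
    with U have "x \<in> X" by blast
    then consider "x \<in> set xs" | "c = ConvE" "x = s"
      unfolding points_def by (cases "c = ConvE") auto
    then show "x \<in> set xs"
    proof cases
      case 2
      with bs hd \<open>x \<in> U\<close> show ?thesis by blast
    qed
  qed
  have "\<exists>(r, h)\<in>outcomes bs U ts.
      card U \<le> mistakes L (\<lambda>S. R S r) h xs + calls L (\<lambda>S. R S r) h xs"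
    by (rule adversary[where Inv = Inv, OF step snoc cons init(1)
          config_finite[OF init(2)] bs(2) L sub])
  then obtain r h where rh: "(r, h) \<in> outcomes bs U ts"
      "card U \<le> mistakes L (\<lambda>S. R S r) h xs + calls L (\<lambda>S. R S r) h xs"
    by blast
  obtain z where "(r, z) \<in> problem_instances c s xs" "threshold r z = h"
    using outcomes_instance[OF init(2) rh(1)] .
  with rh(2) show "\<exists>I\<in>problem_instances c s xs. card U \<le> num_mistakes R xs L I + num_calls R xs L I"
    by (intro bexI[of _ "(r, z)"]) (auto simp: num_mistakes_def num_calls_def)
qed

text \<open>Cut any valid list after the prefix with cutoff \<open>n\<close> and forget the order of
  the rest.\<close>

lemma initial_config:
  assumes "n \<in> {eps c..T}"
  obtains bs U where "config bs U []" "length bs + eps c = Suc n" "card U = T - n"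
proof -
  obtain l where l: "valid l"
  proof (cases c)
    case ConvE
    then have "valid (s # xs)"
      using ann xs_distinct unfolding valid_def enumerates_def announced_def points_def by simp
    then show ?thesis by (rule that)
  next
    case ConvN
    then have "valid xs" using xs_distinct unfolding valid_def enumerates_def points_def by simp
    then show ?thesis by (rule that)
  qed
  define j where "j = Suc n - eps c"
  have j: "0 < j" "j \<le> length l" "length l - j = T - n" "j + eps c = Suc n"
    using assms valid_length[OF l] unfolding j_def atLeastAtMost_iff by linarith+
  obtain bs us where bs: "l = bs @ us" "length bs = j"
    using j(2) by (metis append_take_drop_id length_take min.absorb2)
  have nonempty: "bs \<noteq> []" using bs(2) j(1) by auto
  have d: "distinct bs" "distinct us" "set bs \<inter> set us = {}" "set bs \<union> set us = X"
    using l unfolding valid_def enumerates_def bs(1) by auto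
  have hd: "c = ConvE \<longrightarrow> hd bs = s"
    using l nonempty unfolding valid_def bs(1) by simp
  have "config bs (set us) []"
    unfolding config_def using nonempty d hd by simp
  moreover have "card (set us) = T - n"
    using d(2) j(3) bs by (simp add: distinct_card)
  ultimately show ?thesis using that j(4) bs(2) by blast
qed

lemma nearest_forces_above:
  assumes rule: "nearest_rule c s xs m R" and m: "m \<in> {eps c..T}"
  shows "forces_total c s xs R (T - m)"
proof -
  obtain bs U where init: "config bs U []" "length bs + eps c = Suc m" "card U = T - m"
    using initial_config[OF m] .
  \<comment> \<open>The inequality says that the cutoff of \<open>bs\<close> is at least
    \<open>m\<close>, so that \<open>m\<close> lies in the lower window. It persists because
    \<open>bs\<close> never shrinks.\<close>
  define Inv where "Inv = (\<lambda>bs U ts. config bs U ts \<and> m < length bs + eps c)"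
  have "forces_total c s xs R (card U)"
  proof (rule adversary_forces[where Inv = Inv and bs = bs and U = U and ts = "[]"])
    fix bs U ts and S :: "'a sample"
    assume inv: "Inv bs U ts" and S: "S \<subseteq> X \<times> UNIV"
    consider "\<forall>x. (x, True) \<in> S \<longrightarrow> x \<in> set bs" | x where "(x, True) \<in> S" "x \<in> set ts"
      | x where "(x, True) \<in> S" "x \<in> U"
    proof -
      have "x \<in> set bs \<union> U \<union> set ts" if "(x, True) \<in> S" for x
        using that inv S unfolding Inv_def config_def set_append by blast
      then show ?thesis using that by blast
    qed
    then show "determined R S bs U ts \<or> (\<exists>a\<in>U. determined R S (bs @ [a]) (U - {a}) ts) \<or>
        (\<exists>a\<in>U. determined R S bs (U - {a}) (a # ts))"
    proof cases
      case 1
      then show ?thesis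
        using determined_positive_low[OF _ rule] inv m unfolding Inv_def atLeastAtMost_iff by blast
    next
      case 2
      then show ?thesis
        using determined_positive_high[OF _ rule] inv unfolding Inv_def atLeastAtMost_iff by blast
    next
      case 3
      then have "determined R S bs (U - {x}) (x # ts)"
        using inv by (intro determined_positive_high[OF config_cons rule, of bs U ts x x])
          (simp_all add: Inv_def)
      with 3 show ?thesis by blast
    qed
  next
    show "Inv bs U []" using init by (simp add: Inv_def)
  qed (simp_all add: Inv_def config_snoc config_cons init(1))
  with init show ?thesis by simp
qed

text \<open>\<open>nearest_forces_above\<close> with \<open>m = T\<close> would only force
  \<open>0\<close>. Dually, \<open>T\<close> always lies in the upper window, so \<open>bs\<close>
  can start with a single element; an uncommitted element that the sample labels negative goes to
  the bottom segment.\<close>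

lemma largest_forces: "forces_total c s xs (largest_rule c s xs) (T - eps c)"
proof -
  note rule = largest_nearest
  obtain bs U where init: "config bs U []" "length bs + eps c = Suc (eps c)" "card U = T - eps c"
    using initial_config[of "eps c"] eps_le by auto
  have "forces_total c s xs (largest_rule c s xs) (card U)"
  proof (rule adversary_forces[where Inv = config and bs = bs and U = U and ts = "[]"])
    fix bs U ts and S :: "'a sample"
    assume inv: "config bs U ts" and S: "S \<subseteq> X \<times> UNIV"
    consider "\<forall>x. (x, False) \<in> S \<longrightarrow> x \<notin> set bs \<union> U" | x where "(x, False) \<in> S" "x \<in> set bs"
      | x where "(x, False) \<in> S" "x \<in> U"
      by blast
    then show "determined (largest_rule c s xs) S bs U ts \<or>
        (\<exists>a\<in>U. determined (largest_rule c s xs) S (bs @ [a]) (U - {a}) ts) \<or>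
        (\<exists>a\<in>U. determined (largest_rule c s xs) S bs (U - {a}) (a # ts))"
    proof cases
      case 1
      then show ?thesis
        using determined_negative_high[OF inv rule] by blast
    next
      case 2
      then show ?thesis
        using determined_negative_low[OF inv rule] by blast
    next
      case 3
      then have "determined (largest_rule c s xs) S (bs @ [x]) (U - {x}) ts"
        using inv by (intro determined_negative_low[OF config_snoc rule, of bs U ts x x]) simp_all
      with 3 show ?thesis by blast
    qed
  qed (simp_all add: config_snoc config_cons init(1))
  with init show ?thesis by simp
qed

lemma smallest_forces: "forces_total c s xs (smallest_rule c s xs) (T - eps c)"
  using nearest_forces_above[OF smallest_nearest] eps_le by simp

lemma global_median_range: "global_median c xs \<in> {eps c..T}"
  using eps_le by (auto simp: global_median_def)

lemma global_median_forces:
  "forces_total c s xs (global_median_rule c s xs) (T - global_median c xs)"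
  using nearest_forces_above[OF global_median_nearest global_median_range] .

end

section \<open>Learners\<close>

primrec follow :: "('a \<Rightarrow> bool) \<Rightarrow> 'a list \<Rightarrow> 'a learner" where
  "follow h [] = Halt"
| "follow h (x # xs) = Predict (h x) (\<lambda>_. follow h xs)"

lemma follow_queries_within: "queries_within A (follow h ys)"
  and follow_calls: "calls (follow h ys) orc g ys = 0"
  and follow_mistakes: "mistakes (follow h ys) orc g ys = length (filter (\<lambda>x. h x \<noteq> g x) ys)"
  by (induction ys) auto

text \<open>\<open>K\<close> also receives the point of the mistake, so that the continuation can
  correct \<open>h\<close> there.\<close>

primrec until_mistake :: "('a \<Rightarrow> bool) \<Rightarrow> ('a \<Rightarrow> 'a sample \<Rightarrow> 'a list \<Rightarrow> 'a learner) \<Rightarrow>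
    'a sample \<Rightarrow> 'a list \<Rightarrow> 'a learner" where
  "until_mistake h K S [] = Halt"
| "until_mistake h K S (x # xs) = Predict (h x) (\<lambda>y.
     if y = h x then until_mistake h K (insert (x, y) S) xs else K x (insert (x, y) S) xs)"

text \<open>
  \<open>S\<close> holds the labels seen so far and \<open>H\<close> is the guess used once the budget of calls is spent.
  If \<open>h\<close> wrongly labels \<open>x\<close> positive and the next cutoff below that of \<open>h\<close> is still feasible,
  then the concept with that cutoff is \<open>h(x := False)\<close>.
\<close>

primrec halving :: "nat \<Rightarrow> ('a \<Rightarrow> bool) \<Rightarrow> 'a sample \<Rightarrow> 'a list \<Rightarrow> 'a learner" where
  "halving 0 H S xs = follow H xs"
| "halving (Suc j) H S xs = Query S (\<lambda>a. case a of None \<Rightarrow> Halt | Some h \<Rightarrow>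
     until_mistake h (\<lambda>x. halving j (if h x then h(x := False) else H)) S xs)"

lemma until_mistake_queries_within:
  assumes "\<And>x S zs. S \<subseteq> A \<times> UNIV \<Longrightarrow> set zs \<subseteq> A \<Longrightarrow> queries_within A (K x S zs)"
    and "S \<subseteq> A \<times> UNIV" "set ys \<subseteq> A"
  shows "queries_within A (until_mistake h K S ys)"
  using assms(2,3) by (induction ys arbitrary: S) (auto intro: assms(1))

lemma halving_queries_within:
  "S \<subseteq> A \<times> UNIV \<Longrightarrow> set ys \<subseteq> A \<Longrightarrow> queries_within A (halving j H S ys)"
proof (induction j arbitrary: H S ys)
  case (Suc j)
  then show ?case
    by (auto intro!: until_mistake_queries_within split: option.split)
qed (simp add: follow_queries_within)

lemma until_mistake_calls:
  assumes "\<And>x S zs. calls (K x S zs) orc g zs \<le> n"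
  shows "calls (until_mistake h K S ys) orc g ys \<le> n"
  by (induction ys arbitrary: S) (simp_all add: assms)

lemma halving_calls: "calls (halving j H S ys) orc g ys \<le> j"
proof (induction j arbitrary: H S ys)
  case (Suc j)
  then show ?case by (simp add: until_mistake_calls split: option.split)
qed (simp add: follow_calls)

text \<open>The sample grows while \<open>h\<close> is followed, so the bound on the continuation is
  demanded for every consistent extension of \<open>S\<close> that contains the refuting
  label.\<close>

lemma until_mistake_mistakes:
  assumes "\<And>x S' zs. x \<in> A \<Longrightarrow> set zs \<subseteq> A \<Longrightarrow> h x \<noteq> g x \<Longrightarrow> S \<subseteq> S' \<Longrightarrow> (x, g x) \<in> S' \<Longrightarrow>
      consistent g S' \<Longrightarrow> mistakes (K x S' zs) orc g zs \<le> n"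
    and "S \<subseteq> S0" "consistent g S0" "set ys \<subseteq> A"
  shows "mistakes (until_mistake h K S0 ys) orc g ys \<le> Suc n"
  using assms(2-)
proof (induction ys arbitrary: S0)
  case (Cons x ys)
  have c: "consistent g (insert (x, g x) S0)" using Cons.prems(2) by (simp add: consistent_def)
  show ?case
  proof (cases "h x = g x")
    case True
    have "mistakes (until_mistake h K (insert (x, g x) S0) ys) orc g ys \<le> Suc n"
      using c Cons.prems by (intro Cons.IH) auto
    with True show ?thesis by simp
  next
    case False
    have "mistakes (K x (insert (x, g x) S0) ys) orc g ys \<le> n"
      using c Cons.prems False by (intro assms(1)) auto
    with False show ?thesis by auto
  qed
qed simp

section \<open>Mistake bound for halving, and distances between prefixes\<close>

context ordered_setting
begin

lemma feasible_antimono: "S \<subseteq> S' \<Longrightarrow> F S' \<subseteq> F S"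
  unfolding feasible_iff[abs_def] subset_iff feasible_iff consistent_def by blast

lemma feasible_agree: "(x, y) \<in> S \<Longrightarrow> k \<in> F S \<Longrightarrow> pre k x = y"
  unfolding feasible_iff consistent_def by auto

text \<open>The nested positive sets have sizes \<open>p - 1\<close> and \<open>p\<close>, so they
  differ in a single announced point, which must be \<open>x\<close>.\<close>

lemma prefix_Suc_pred:
  assumes p: "p \<in> {eps c..T}" "p - 1 \<in> {eps c..T}" "0 < p"
    and x: "x \<in> set xs" "pre p x" "\<not> pre (p - 1) x" and y: "y \<in> set xs"
  shows "((pre p)(x := False)) y = pre (p - 1) y"
proof -
  let ?A = "{y \<in> set xs. pre p y}" and ?B = "{y \<in> set xs. pre (p - 1) y}"
  have "?B \<subseteq> ?A - {x}" using prefix_mono[OF p(2,1)] x(3) by auto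
  moreover have "card ?B = p - 1" "card ?A = p"
    using cutoff_prefix p(1,2) by (simp_all add: cutoff_def)
  then have "card ?B = card (?A - {x})" using x by simp
  ultimately have "?B = ?A - {x}" by (intro card_subset_eq) auto
  with y show ?thesis by auto
qed

text \<open>
  Every mistake on the median at least halves the number of feasible cutoffs. A further call to
  learn the last candidate is saved: it would be needed only if all halvings are exact, and then
  the surviving interval ends at the old right end or, after a wrong positive label, just below
  the median, so that \<open>H\<close> already is this candidate. The flag \<open>first\<close> admits the \<open>T + 1\<close> cutoffs
  of \<open>ConvE\<close> for \<open>T = 2 ^ j\<close>.
\<close>

lemma halving_mistakes:
  assumes "consistent g S" "g = pre k" "k \<in> {eps c..T}"
    and "Max (F S) + 1 - Min (F S) \<le> 2 ^ j + (if first \<and> j \<noteq> 0 then 1 else 0)"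
    and "2 ^ j \<le> Max (F S) + 1 - Min (F S) \<Longrightarrow> \<forall>y\<in>set xs. H y = pre (Max (F S)) y"
    and "set ys \<subseteq> set xs"
  shows "mistakes (halving j H S ys) (\<lambda>S. feasible_median_rule c s xs S r) g ys \<le> j"
  using assms
proof (induction j arbitrary: H S ys first)
  case 0
  have "k \<in> F S" using "0.prems" by (simp add: feasible_iff)
  then have "Min (F S) \<le> k" "k \<le> Max (F S)" using finite_feasible by auto
  \<comment> \<open>For \<open>j = 0\<close> the width bound leaves one feasible cutoff, and the
    hypothesis on \<open>H\<close> makes the guess exact.\<close>
  with "0.prems"(4,5) have "k = Max (F S)" "\<forall>y\<in>set xs. H y = pre (Max (F S)) y" by auto
  with "0.prems"(2,6) show ?case by (auto simp: follow_mistakes filter_empty_conv)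
next
  case (Suc j)
  define l u where "l = Min (F S)" and "u = Max (F S)"
  define p where "p = (l + u) div 2"
  have k: "k \<in> F S" using Suc.prems by (simp add: feasible_iff)
  then have ne: "F S \<noteq> {}" by auto
  have lu: "l \<le> u" using feasible_Min_le_Max[OF ne] by (simp add: l_def u_def)
  have p: "p \<in> {eps c..T}"
    using feasible_between[OF ne, of p] lu unfolding p_def l_def u_def feasible_iff by auto
  have pos: "1 \<le> (2 :: nat) ^ j" by simp
  have p2: "2 * p \<le> l + u" "l + u \<le> 2 * p + 1" unfolding p_def by linarith+
  have width: "u + 1 - l \<le> 2 * 2 ^ j + 1"
    using Suc.prems(4) unfolding l_def u_def by (simp split: if_splits)
  have answer: "feasible_median_rule c s xs S r = Some (pre p)"
    using ne by (simp add: feasible_median_rule_def cutoff_rule_def Let_def p_def l_def u_def)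
  have "mistakes (until_mistake (pre p)
      (\<lambda>x. halving j (if pre p x then (pre p)(x := False) else H)) S ys)
      (\<lambda>S. feasible_median_rule c s xs S r) g ys \<le> Suc j"
  proof (rule until_mistake_mistakes[where A = "set xs" and S = S])
    fix x S' zs
    assume x: "x \<in> set xs" and zs: "set zs \<subseteq> set xs" and wrong: "pre p x \<noteq> g x"
      and S': "S \<subseteq> S'" "(x, g x) \<in> S'" "consistent g S'"
    define l' u' where "l' = Min (F S')" and "u' = Max (F S')"
    have "k \<in> F S'" using S'(3) Suc.prems by (simp add: feasible_iff)
    then have "l' \<in> F S'" "u' \<in> F S'"
      using finite_feasible Min_in Max_in unfolding l'_def u'_def by blast+
    then have sub: "l' \<in> F S" "u' \<in> F S" and range: "l' \<in> {eps c..T}" "u' \<in> {eps c..T}"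
      and agree: "pre l' x = g x" "pre u' x = g x"
      using feasible_antimono[OF S'(1)] feasible_agree[OF S'(2)] by (auto simp only: feasible_iff)
    have bounds: "l \<le> l'" "u' \<le> u" using sub finite_feasible by (auto simp: l_def u_def)
    show "mistakes (halving j (if pre p x then (pre p)(x := False) else H) S' zs)
        (\<lambda>S. feasible_median_rule c s xs S r) g zs \<le> j"
    proof (cases "pre p x")
      case True
      \<comment> \<open>The surviving prefixes label \<open>x\<close> negative and the median does
        not, so the whole surviving interval lies below \<open>p\<close>.\<close>
      then have "\<not> pre u' x" using agree wrong by simp
      then have "\<not> p \<le> u'" using prefix_mono[OF p range(2) _ True] by blast
      then have half: "u' < p" by simp
      have "mistakes (halving j ((pre p)(x := False)) S' zs)
          (\<lambda>S. feasible_median_rule c s xs S r) g zs \<le> j"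
      proof (rule Suc.IH[where first = False, OF S'(3) Suc.prems(2,3) _ _ zs])
        have "u' + 1 - l' \<le> 2 ^ j" using half bounds width lu p2 by linarith
        then show "Max (F S') + 1 - Min (F S') \<le> 2 ^ j + (if False \<and> j \<noteq> 0 then 1 else 0)"
          by (simp add: l'_def u'_def)
        assume "2 ^ j \<le> Max (F S') + 1 - Min (F S')"
        then have large: "2 ^ j \<le> u' + 1 - l'" by (simp add: l'_def u'_def)
        \<comment> \<open>Since \<open>p - l \<le> 2 ^ j\<close>, an interval of full width
          \<open>2 ^ j\<close> must end directly below the median; flipping \<open>x\<close> in
          \<open>pre p\<close> then gives the prefix at its right end.\<close>
        have u': "u' = p - 1" using half bounds width lu p2 large pos by linarith
        have "((pre p)(x := False)) y = pre (p - 1) y" if "y \<in> set xs" for y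
          by (rule prefix_Suc_pred[OF p _ _ x True _ that])
            (use u' half range \<open>\<not> pre u' x\<close> in auto)
        then show "\<forall>y\<in>set xs. ((pre p)(x := False)) y = pre (Max (F S')) y"
          using u' by (simp add: u'_def)
      qed
      with True show ?thesis by simp
    next
      case False
      then have "pre l' x" using agree wrong by simp
      then have "\<not> l' \<le> p" using prefix_mono[OF range(1) p] False by blast
      then have half: "p < l'" by simp
      have "mistakes (halving j H S' zs) (\<lambda>S. feasible_median_rule c s xs S r) g zs \<le> j"
      proof (rule Suc.IH[where first = False, OF S'(3) Suc.prems(2,3) _ _ zs])
        have "u' + 1 - l' \<le> 2 ^ j" using half bounds width lu p2 by linarith
        then show "Max (F S') + 1 - Min (F S') \<le> 2 ^ j + (if False \<and> j \<noteq> 0 then 1 else 0)"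
          by (simp add: l'_def u'_def)
        assume "2 ^ j \<le> Max (F S') + 1 - Min (F S')"
        then have large: "2 ^ j \<le> u' + 1 - l'" by (simp add: l'_def u'_def)
        \<comment> \<open>Here at most \<open>u - p\<close> cutoffs survive. Reaching
          \<open>2 ^ j\<close> forces an unchanged right end and an old width of at least
          \<open>2 * 2 ^ j\<close>, so the hypothesis on \<open>H\<close> carries over.\<close>
        have "u' = u" "2 * 2 ^ j \<le> u + 1 - l"
          using half bounds width lu p2 large pos by linarith+
        then show "\<forall>y\<in>set xs. H y = pre (Max (F S')) y"
          using Suc.prems(5) unfolding u'_def[symmetric] l_def[symmetric] u_def[symmetric] by simp
      qed
      with False show ?thesis by simp
    qed
  qed (use Suc.prems in auto)
  then show ?case by (simp add: answer)
qed

lemma threshold_prefix: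
  assumes "z \<in> X"
  obtains k where "k \<in> {eps c..T}" "threshold r z = pre k"
  using concept_cases[of "threshold r z"] assms by (auto simp: concepts_def)

lemma prefix_top: "x \<in> set xs \<Longrightarrow> pre T x"
proof -
  assume x: "x \<in> set xs"
  have "card {x \<in> set xs. pre T x} = card (set xs)"
    using cutoff_prefix[of T] eps_le card_set_xs by (simp add: cutoff_def)
  then have "{x \<in> set xs. pre T x} = set xs" by (intro card_subset_eq) auto
  with x show ?thesis by blast
qed

lemma prefix_difference:
  assumes "k \<in> {eps c..T}" "k' \<in> {eps c..T}" "k \<le> k'"
  shows "card {x \<in> set xs. pre k x \<noteq> pre k' x} = k' - k"
proof -
  have "{x \<in> set xs. pre k x \<noteq> pre k' x} = {x \<in> set xs. pre k' x} - {x \<in> set xs. pre k x}"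
    using prefix_mono[OF assms] by blast
  moreover have "{x \<in> set xs. pre k x} \<subseteq> {x \<in> set xs. pre k' x}"
    using prefix_mono[OF assms] by blast
  ultimately show ?thesis
    using cutoff_prefix[OF assms(1)] cutoff_prefix[OF assms(2)]
    by (simp add: card_Diff_subset cutoff_def)
qed

end

section \<open>Upper bounds over all instances\<close>

context setting
begin

lemma instanceE:
  assumes "I \<in> problem_instances c s xs"
  obtains r z k where "I = (r, z)" "ordered_setting c s xs r" "z \<in> X" "k \<in> {eps c..T}"
    "threshold r z = prefix_concept c s xs r k"
proof -
  obtain r z where I: "I = (r, z)" "admissible c s xs r" "z \<in> X"
    using assms by (auto simp: problem_instances_def)
  interpret ordered_setting c s xs r using I(2) by unfold_locales
  obtain k where "k \<in> {eps c..T}" "threshold r z = pre k" using threshold_prefix[OF I(3)] .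
  then show ?thesis using that[OF I(1) ordered_setting_axioms I(3)] by blast
qed

lemma feasible_median_learner:
  assumes "2 \<le> T"
  shows "\<exists>L\<in>learners c s xs. \<forall>I\<in>problem_instances c s xs.
    int (num_calls (feasible_median_rule c s xs) xs L I) \<le> \<lceil>log 2 (real T)\<rceil> \<and>
    int (num_mistakes (feasible_median_rule c s xs) xs L I) \<le> \<lceil>log 2 (real T)\<rceil>"
proof -
  define j where "j = nat \<lceil>log 2 (real T)\<rceil>"
  have log: "0 < log 2 (real T)" using assms by (subst zero_less_log_cancel_iff) auto
  then have j: "int j = \<lceil>log 2 (real T)\<rceil>" "0 < j" by (simp_all add: j_def)
  have "real T = 2 powr log 2 (real T)" using xs_nonempty by simp
  also have "\<dots> \<le> 2 powr real j"
    by (rule powr_mono) (use j(1) in linarith, simp)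
  also have "\<dots> = real (2 ^ j)" by (simp add: powr_realpow)
  finally have T: "T \<le> 2 ^ j" by (simp only: of_nat_le_iff)
  \<comment> \<open>The guess \<open>True\<close> agrees with the prefix for the largest cutoff
    \<open>T\<close>, as the hypothesis on \<open>H\<close> in \<open>halving_mistakes\<close>
    requires.\<close>
  define L where "L = halving j (\<lambda>_. True) {} xs"
  have "num_calls (feasible_median_rule c s xs) xs L I \<le> j" for I
    by (simp add: num_calls_def L_def halving_calls split: prod.split)
  moreover have "num_mistakes (feasible_median_rule c s xs) xs L I \<le> j"
    if "I \<in> problem_instances c s xs" for I
    using that
  proof (rule instanceE)
    fix r z k
    assume I: "I = (r, z)" "ordered_setting c s xs r" "z \<in> X" "k \<in> {eps c..T}"
      "threshold r z = prefix_concept c s xs r k"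
    interpret ordered_setting c s xs r by (rule I(2))
    have "Min (F {}) = eps c" "Max (F {}) = T"
      using eps_le by (auto simp: feasible_empty_sample intro: Min_eqI Max_eqI)
    \<comment> \<open>Initially there are \<open>T + 1 - eps c \<le> 2 ^ j + 1\<close> cutoffs;
      \<open>first = True\<close> admits the extra one because \<open>j > 0\<close>.\<close>
    then have "mistakes (halving j (\<lambda>_. True) {} xs) (\<lambda>S. feasible_median_rule c s xs S r)
        (pre k) xs \<le> j"
      using I(4) T j(2) prefix_top by (intro halving_mistakes[where first = True]) (auto simp: consistent_def)
    then show ?thesis by (simp add: num_mistakes_def I L_def)
  qed
  moreover have "L \<in> learners c s xs"
    unfolding learners_def L_def by (auto intro!: halving_queries_within simp: points_def)
  ultimately show ?thesis
    unfolding j(1)[symmetric] of_nat_le_iff by (intro bexI[of _ L] ballI conjI)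
qed

text \<open>Always predicting \<open>True\<close> risks only the single round, and under
  \<open>ConvN\<close> the only cutoff is \<open>1\<close>, which makes it correct.\<close>

lemma single_learner:
  assumes "T = 1"
  shows "\<exists>L\<in>learners c s xs. \<forall>I\<in>problem_instances c s xs.
    num_calls R xs L I = 0 \<and> num_mistakes R xs L I \<le> (case c of ConvE \<Rightarrow> 1 | ConvN \<Rightarrow> 0)"
proof (intro bexI ballI)
  let ?L = "follow (\<lambda>_. True) xs"
  show "?L \<in> learners c s xs" by (simp add: learners_def follow_queries_within)
  fix I
  assume I: "I \<in> problem_instances c s xs"
  then show "num_calls R xs ?L I = 0 \<and> num_mistakes R xs ?L I \<le> (case c of ConvE \<Rightarrow> 1 | ConvN \<Rightarrow> 0)"
  proof (rule instanceE)
    fix r z k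
    assume I: "I = (r, z)" "ordered_setting c s xs r" "z \<in> X" "k \<in> {eps c..T}"
      "threshold r z = prefix_concept c s xs r k"
    interpret ordered_setting c s xs r by (rule I(2))
    have "length (filter (\<lambda>x. True \<noteq> threshold r z x) xs) \<le> (case c of ConvE \<Rightarrow> 1 | ConvN \<Rightarrow> 0)"
    proof (cases c)
      case ConvE
      have "length (filter (\<lambda>x. True \<noteq> threshold r z x) xs) \<le> length xs"
        by (rule length_filter_le)
      with ConvE assms show ?thesis by simp
    next
      case ConvN
      then have "k = T" using I(4) assms by simp
      then show ?thesis using ConvN prefix_top by (simp add: I(5) filter_empty_conv)
    qed
    then show ?thesis
      by (simp add: I(1) num_calls_def num_mistakes_def follow_calls follow_mistakes)
  qed
qed

lemma global_median_learner:
  "\<exists>L\<in>learners c s xs. \<forall>I\<in>problem_instances c s xs.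
    num_calls (global_median_rule c s xs) xs L I = 1 \<and>
    int (num_mistakes (global_median_rule c s xs) xs L I) \<le> \<lceil>real T / 2\<rceil>"
proof (intro bexI ballI)
  let ?L = "Query {} (\<lambda>a. follow (the a) xs)"
  let ?m = "global_median c xs"
  show "?L \<in> learners c s xs" by (simp add: learners_def follow_queries_within)
  fix I
  assume I: "I \<in> problem_instances c s xs"
  then show "num_calls (global_median_rule c s xs) xs ?L I = 1 \<and>
      int (num_mistakes (global_median_rule c s xs) xs ?L I) \<le> \<lceil>real T / 2\<rceil>"
  proof (rule instanceE)
    fix r z k
    assume I: "I = (r, z)" "ordered_setting c s xs r" "z \<in> X" "k \<in> {eps c..T}"
      "threshold r z = prefix_concept c s xs r k"
    interpret ordered_setting c s xs r by (rule I(2))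
    have "Min (F {}) = eps c" "Max (F {}) = T"
      using eps_le by (auto simp: feasible_empty_sample intro: Min_eqI Max_eqI)
    then have answer: "global_median_rule c s xs {} r = Some (pre ?m)"
      using global_median_range eps_le
      by (simp add: global_median_rule_def cutoff_rule_def Let_def feasible_empty_sample)
    have "length (filter (\<lambda>x. pre ?m x \<noteq> pre k x) xs) = card {x \<in> set xs. pre ?m x \<noteq> pre k x}"
      using xs_distinct by (simp add: distinct_length_filter Int_def conj_commute)
    also have "\<dots> \<le> max (?m - k) (k - ?m)"
    proof (cases "k \<le> ?m")
      case True
      then show ?thesis using prefix_difference[OF I(4) global_median_range] by (simp add: eq_commute)
    next
      case False
      then show ?thesis using prefix_difference[OF global_median_range I(4)] by simp
    qed
    finally have "num_mistakes (global_median_rule c s xs) xs ?L I \<le> max (?m - k) (k - ?m)"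
      by (simp add: I(1,5) num_mistakes_def answer follow_mistakes)
    \<comment> \<open>The distance from the global median is largest at an end of the cutoff range,
      and neither half exceeds \<open>(T + 1) div 2\<close>.\<close>
    also have "\<dots> \<le> (T + 1) div 2"
      using I(4) by (cases c) (auto simp: global_median_def)
    finally have "int (num_mistakes (global_median_rule c s xs) xs ?L I) \<le> int ((T + 1) div 2)"
      by simp
    also have "int ((T + 1) div 2) \<le> \<lceil>real T / 2\<rceil>" by linarith
    finally show ?thesis by (simp add: I(1) num_calls_def follow_calls)
  qed
qed

end

text \<open>Only oracle answers, identical for both targets, precede the single prediction, so it is
  the same for both and wrong for one.\<close>

lemma mistake_on_one_target:
  "h x \<noteq> h' x \<Longrightarrow> mistakes L orc h [x] \<noteq> 0 \<or> mistakes L orc h' [x] \<noteq> 0"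
  by (induction L) auto

context setting
begin

text \<open>Under the order \<open>[s, x]\<close> the targets \<open>s\<close> and \<open>x\<close>
  give the single instance opposite labels.\<close>

lemma single_forced_mistake:
  assumes "T = 1" "c = ConvE"
  shows "card X = 2" "L \<in> learners c s xs \<Longrightarrow> \<exists>I\<in>problem_instances c s xs. num_mistakes R xs L I \<noteq> 0"
proof -
  show "card X = 2" using card_points assms by simp
  obtain x where xs: "xs = [x]" using assms(1) by (cases xs) auto
  then have sx: "s \<noteq> x" using ann assms(2) by (auto simp: announced_def)
  have X: "X = {s, x}" using xs assms(2) by (auto simp: points_def)
  define r where "r = list_order [s, x]"
  have v: "valid [s, x]" using sx X by (simp add: valid_def enumerates_def)
  have "threshold r s = (\<lambda>y. y \<in> {s})" "threshold r x = (\<lambda>y. y \<in> {s, x})"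
    using threshold_list_order[OF v, of 1] threshold_list_order[OF v, of 2] by (simp_all add: r_def)
  then have "threshold r s x \<noteq> threshold r x x" using sx by simp
  then have "mistakes L (\<lambda>S. R S r) (threshold r s) [x] \<noteq> 0 \<or>
      mistakes L (\<lambda>S. R S r) (threshold r x) [x] \<noteq> 0"
    by (rule mistake_on_one_target)
  moreover have "(r, s) \<in> problem_instances c s xs" "(r, x) \<in> problem_instances c s xs"
    using list_order_admissible[OF v] X by (simp_all add: problem_instances_def r_def)
  ultimately show "\<exists>I\<in>problem_instances c s xs. num_mistakes R xs L I \<noteq> 0"
    unfolding num_mistakes_def xs by force
qed

end

section \<open>Asymptotic consequences\<close>

lemma ln_smallo: "(\<lambda>T. ln (real T)) \<in> o(\<lambda>T. real T)"
  by (rule smalloI_tendsto, rule filterlim_compose[OF ln_x_over_x_tendsto_0 filterlim_real_sequentially])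
    (auto simp: eventually_sequentially intro: exI[of _ 1])

lemma eventually_twice_log_less:
  "\<forall>\<^sub>F T in sequentially. 2 * \<lceil>log 2 (real T)\<rceil> < int (T - 1)"
proof -
  have "\<forall>\<^sub>F T in sequentially. norm (ln (real T)) \<le> 1 / 8 * norm (real T)"
    by (rule landau_o.smallD[OF ln_smallo]) simp
  then have "\<forall>\<^sub>F T in sequentially. 2 * (log 2 (real T) + 1) < real T - 1"
    using eventually_gt_at_top[of 6]
  proof eventually_elim
    case (elim T)
    \<comment> \<open>Together with the factor \<open>1 / 8\<close>, the bound
      \<open>ln 2 \<ge> 1 / 2\<close> gives \<open>log 2 T \<le> T / 4\<close>. The claim then
      follows from \<open>T / 2 + 2 < T - 1\<close>, that is, \<open>T > 6\<close>.\<close>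
    have "exp (1 / 2 :: real) ^ 2 = exp 1" by (simp flip: exp_of_nat_mult)
    also have "\<dots> \<le> 2 ^ 2" using exp_le by simp
    finally have "exp (1 / 2 :: real) \<le> 2" by (rule power2_le_imp_le) simp
    then have "1 / 2 \<le> ln (2 :: real)" by (subst ln_ge_iff) simp_all
    then have "1 / 2 * log 2 (real T) \<le> ln 2 * log 2 (real T)"
      using elim(2) by (intro mult_right_mono) auto
    also have "\<dots> = ln (real T)" by (simp add: log_def)
    finally have "1 / 2 * log 2 (real T) \<le> 1 / 8 * real T" using elim(1) by simp
    moreover have "6 < real T" using elim(2) by simp
    ultimately show ?case by (simp add: field_simps)
  qed
  then show ?thesis
  proof (rule eventually_mono)
    fix T :: nat
    assume "2 * (log 2 (real T) + 1) < real T - 1"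
    moreover have "real_of_int \<lceil>log 2 (real T)\<rceil> < log 2 (real T) + 1"
      using ceiling_correct[of "log 2 (real T)"] by linarith
    ultimately have "real_of_int (2 * \<lceil>log 2 (real T)\<rceil>) < real_of_int (int T - 1)"
      unfolding of_int_mult of_int_diff by simp
    then have "2 * \<lceil>log 2 (real T)\<rceil> < int T - 1" by (simp only: of_int_less_iff)
    then show "2 * \<lceil>log 2 (real T)\<rceil> < int (T - 1)" by linarith
  qed
qed

text \<open>The feasible-median rule is the counterexample: its learner has total cost at most
  \<open>2 * \<lceil>log 2 T\<rceil>\<close>, eventually below \<open>T - 1\<close>.\<close>

lemma not_all_rules_force:
  "\<forall>\<^sub>F T in sequentially. \<forall>(s :: 'a) xs. announced c s xs \<and> length xs = T \<longrightarrow>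
     \<not> (\<forall>R. legal_oracle c s xs R \<longrightarrow> forces_total c s xs R (T - eps c))"
  using eventually_twice_log_less eventually_ge_at_top[of 2]
proof eventually_elim
  case (elim T)
  show ?case
  proof (intro allI impI notI, elim conjE)
    fix s :: 'a and xs
    assume ann: "announced c s xs" and T: "length xs = T"
      and all: "\<forall>R. legal_oracle c s xs R \<longrightarrow> forces_total c s xs R (T - eps c)"
    interpret setting c s xs using ann by unfold_locales
    let ?R = "feasible_median_rule c s xs"
    have "2 \<le> length xs" using elim(2) T by simp
    from feasible_median_learner[OF this] obtain L where L: "L \<in> learners c s xs"
      "\<forall>I\<in>problem_instances c s xs. int (num_calls ?R xs L I) \<le> \<lceil>log 2 (real (length xs))\<rceil> \<and>
        int (num_mistakes ?R xs L I) \<le> \<lceil>log 2 (real (length xs))\<rceil>"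
      by (rule bexE)
    have "forces_total c s xs ?R (T - eps c)"
      using all feasible_median_legal by simp
    then have "\<exists>I\<in>problem_instances c s xs. T - eps c \<le> num_mistakes ?R xs L I + num_calls ?R xs L I"
      using L(1) unfolding forces_total_def by (rule bspec)
    then obtain I where I: "I \<in> problem_instances c s xs"
        "T - eps c \<le> num_mistakes ?R xs L I + num_calls ?R xs L I"
      by (rule bexE)
    have "int (num_calls ?R xs L I) \<le> \<lceil>log 2 (real T)\<rceil>"
      "int (num_mistakes ?R xs L I) \<le> \<lceil>log 2 (real T)\<rceil>"
      using bspec[OF L(2) I(1)] T by simp_all
    moreover have "eps c \<le> 1" by (cases c) auto
    moreover note I(2) elim(1)
    ultimately show False by linarith
  qed
qed

lemma global_median_not_log:
  fixes s :: "nat \<Rightarrow> 'a"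
  assumes ann: "\<And>T. T \<ge> 1 \<Longrightarrow> announced c (s T) (xs T) \<and> length (xs T) = T"
    and L: "\<And>T. T \<ge> 1 \<Longrightarrow> L T \<in> learners c (s T) (xs T)"
    and f: "f \<in> O(\<lambda>T. ln (real T))" and g: "g \<in> O(\<lambda>T. ln (real T))"
    and bound: "\<And>T I. T \<ge> 1 \<Longrightarrow> I \<in> problem_instances c (s T) (xs T) \<Longrightarrow>
      real (num_mistakes (global_median_rule c (s T) (xs T)) (xs T) (L T) I) \<le> f T \<and>
      real (num_calls (global_median_rule c (s T) (xs T)) (xs T) (L T) I) \<le> g T"
  shows False
proof -
  have "(\<lambda>T. f T + g T) \<in> O(\<lambda>T. ln (real T))" using f g by (rule sum_in_bigo)
  then have "(\<lambda>T. f T + g T) \<in> o(\<lambda>T. real T)" using ln_smallo by (rule landau_o.big_small_trans)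
  then have "\<forall>\<^sub>F T in sequentially. norm (f T + g T) \<le> 1 / 4 * norm (real T)"
    by (rule landau_o.smallD) simp
  with eventually_ge_at_top[of 3]
  have "\<forall>\<^sub>F T in sequentially. 3 \<le> T \<and> norm (f T + g T) \<le> 1 / 4 * norm (real T)"
    by (rule eventually_conj)
  then obtain T where T: "3 \<le> T" "norm (f T + g T) \<le> 1 / 4 * norm (real T)"
    by (auto simp: eventually_sequentially)
  have len: "length (xs T) = T" using ann T(1) by simp
  interpret setting c "s T" "xs T" using ann T(1) by unfold_locales simp
  have "L T \<in> learners c (s T) (xs T)" using L T(1) by simp
  with global_median_forces
  have "\<exists>I\<in>problem_instances c (s T) (xs T). length (xs T) - global_median c (xs T) \<le>
      num_mistakes (global_median_rule c (s T) (xs T)) (xs T) (L T) I +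
      num_calls (global_median_rule c (s T) (xs T)) (xs T) (L T) I"
    unfolding forces_total_def by (rule bspec)
  then obtain I where I: "I \<in> problem_instances c (s T) (xs T)"
      "length (xs T) - global_median c (xs T) \<le>
        num_mistakes (global_median_rule c (s T) (xs T)) (xs T) (L T) I +
        num_calls (global_median_rule c (s T) (xs T)) (xs T) (L T) I"
    by (rule bexE)
  have "global_median c (xs T) \<le> (T + 1) div 2"
    unfolding global_median_def len by (cases c) auto
  \<comment> \<open>The forced cost is thus at least \<open>(T - 1) / 2\<close>, while
    \<open>f T + g T \<le> T / 4\<close>; these are incompatible from \<open>T = 3\<close>
    on.\<close>
  then have "real T - 1 \<le> 2 * real (T - global_median c (xs T))" by linarith
  moreover have "real (T - global_median c (xs T)) \<le> f T + g T"
    using I(2) bound[OF _ I(1)] T(1) unfolding len by fastforce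
  ultimately show False using T by simp
qed

theorem theorem3p4:
  fixes c :: convention
  shows
    "(\<forall>(s :: 'a) xs. announced c s xs \<longrightarrow>
        forces_total c s xs (smallest_rule c s xs) (length xs - eps c) \<and>
        forces_total c s xs (largest_rule c s xs) (length xs - eps c))
     \<and>
     (\<forall>\<^sub>F T in sequentially. \<forall>(s :: 'a) xs. announced c s xs \<and> length xs = T \<longrightarrow>
        \<not> (\<forall>R. legal_oracle c s xs R \<longrightarrow> forces_total c s xs R (T - eps c)))
     \<and>
     (\<forall>(s :: 'a) xs. announced c s xs \<longrightarrow>
        legal_oracle c s xs (feasible_median_rule c s xs) \<and>
        (length xs \<ge> 2 \<longrightarrow>
          (\<exists>L \<in> learners c s xs. \<forall>I \<in> problem_instances c s xs.
             int (num_calls (feasible_median_rule c s xs) xs L I) \<le> \<lceil>log 2 (real (length xs))\<rceil> \<and>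
             int (num_mistakes (feasible_median_rule c s xs) xs L I) \<le> \<lceil>log 2 (real (length xs))\<rceil>)) \<and>
        (length xs = 1 \<longrightarrow>
          (\<exists>L \<in> learners c s xs. \<forall>I \<in> problem_instances c s xs.
             num_calls (feasible_median_rule c s xs) xs L I = 0 \<and>
             num_mistakes (feasible_median_rule c s xs) xs L I
               \<le> (case c of ConvE \<Rightarrow> 1 | ConvN \<Rightarrow> 0))) \<and>
        (length xs = 1 \<and> c = ConvE \<longrightarrow>
          card (points c s xs) = 2 \<and>
          (\<forall>L \<in> learners c s xs. \<exists>I \<in> problem_instances c s xs.
             num_mistakes (feasible_median_rule c s xs) xs L I \<noteq> 0)))
     \<and>
     (\<forall>(s :: 'a) xs. announced c s xs \<longrightarrow>
        legal_oracle c s xs (global_median_rule c s xs) \<and>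
        (\<exists>L \<in> learners c s xs. \<forall>I \<in> problem_instances c s xs.
           num_calls (global_median_rule c s xs) xs L I = 1 \<and>
           int (num_mistakes (global_median_rule c s xs) xs L I) \<le> \<lceil>real (length xs) / 2\<rceil>) \<and>
        forces_total c s xs (global_median_rule c s xs) (length xs - global_median c xs))
     \<and>
     (\<forall>(s :: nat \<Rightarrow> 'a) xs.
        (\<forall>T\<ge>1. announced c (s T) (xs T) \<and> length (xs T) = T) \<longrightarrow>
        \<not> (\<exists>L f g.
             (\<forall>T\<ge>1. L T \<in> learners c (s T) (xs T)) \<and>
             f \<in> O(\<lambda>T. ln (real T)) \<and> g \<in> O(\<lambda>T. ln (real T)) \<and>
             (\<forall>T\<ge>1. \<forall>I \<in> problem_instances c (s T) (xs T).
                real (num_mistakes (global_median_rule c (s T) (xs T)) (xs T) (L T) I) \<le> f T \<and>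
                real (num_calls (global_median_rule c (s T) (xs T)) (xs T) (L T) I) \<le> g T)))"
proof (intro conjI allI impI, goal_cases)
  case 1
  then show ?case by (intro setting.smallest_forces setting.intro)
next
  case 2
  then show ?case by (intro setting.largest_forces setting.intro)
next
  case 3
  show ?case by (rule not_all_rules_force)
next
  case 4
  then show ?case by (intro setting.feasible_median_legal setting.intro)
next
  case 5
  then show ?case by (intro setting.feasible_median_learner setting.intro)
next
  case 6
  then show ?case by (intro setting.single_learner setting.intro)
next
  case (7 s xs)
  then interpret setting c s xs by unfold_locales
  show ?case using 7 single_forced_mistake(1) by blast
next
  case (8 s xs)
  then interpret setting c s xs by unfold_locales
  show ?case using 8 by (intro ballI single_forced_mistake(2)) auto
next
  case 9
  then show ?case by (intro setting.global_median_legal setting.intro)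
next
  case 10
  then show ?case by (intro setting.global_median_learner setting.intro)
next
  case 11
  then show ?case by (intro setting.global_median_forces setting.intro)
next
  case (12 s xs)
  show ?case
  proof (intro notI, elim exE conjE)
    fix L f g
    assume "\<forall>T\<ge>1. L T \<in> learners c (s T) (xs T)"
      "f \<in> O(\<lambda>T. ln (real T))" "g \<in> O(\<lambda>T. ln (real T))"
      "\<forall>T\<ge>1. \<forall>I \<in> problem_instances c (s T) (xs T).
         real (num_mistakes (global_median_rule c (s T) (xs T)) (xs T) (L T) I) \<le> f T \<and>
         real (num_calls (global_median_rule c (s T) (xs T)) (xs T) (L T) I) \<le> g T"
    with 12 show False by (intro global_median_not_log[of c s xs L f g]) blast+
  qed
qed

end
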